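(* Let $\Pi=(\mathcal P,\mathcal L)$ be a polar space of rank $n\ge 3$ and let $k$ be an integer with $0\le k\le n-2$. Let $\Gamma'_k(\Pi)=(\mathcal G_k(\Pi),\mathfrak R_{1,1})$ be the graph whose vertices are the $k$-dimensional singular subspaces of $\Pi$ and in which $X,Y$ are adjacent if and only if $\dim_p(X^\perp\cap Y)=k-1$ and $\dim_p(X\cap Y)=k-1$. Then every automorphism of the graph $\Gamma'_k(\Pi)$ is induced by an automorphism of $\Pi$.
   Context: A partial linear space is a pair $(\mathcal P,\mathcal L)$, where $\mathcal P$ is a non-empty set of points and $\mathcal L$ is a family of proper subsets of $\mathcal P$ (lines), such that each line contains at least two points and any two distinct collinear points (distinct points lying on a common line) lie on exactly one line. A subspace is a set $S\subset\mathcal P$ containing the line through any two distinct collinear points of $S$; it is singular if any two of its distinct points are collinear (the empty set and single points are singular subspaces). A polar space is a partial linear space such that: (P1) each line contains at least three points; (P2) no point is collinear to all points; (P3) if $p$ is a point and $L$ a line, then $p$ is collinear to exactly one point or to all points of $L$; (P4) every flag formed by singular subspaces is finite. It has rank $n$ ($n\ge 3$) if its maximal singular subspaces are projective spaces of dimension $n-1$. $\dim_p$ denotes projective dimension ($\dim_p\emptyset=-1$, points have dimension $0$). $\mathcal G_k(\Pi)$ is the set of singular subspaces of projective dimension $k$. For $X\subset\mathcal P$, $X^\perp$ is the set of points collinear to all points of $X$ (a point counts as collinear to itself). An automorphism of $\Pi$ is a bijective transformation of $\mathcal P$ preserving $\mathcal L$; it induces the transformation $S\mapsto\varphi(S)$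 of $\mathcal G_k(\Pi)$. *)

theory Defs
  imports Main "HOL.Hull"
begin

text \<open>A point-line geometry is given by its set of points \<open>P\<close> and its set of lines \<open>L\<close>.\<close>

locale partial_linear_space =
  fixes P :: "'a set" and L :: "'a set set"
  assumes points_nonempty: "P \<noteq> {}"
    and line_proper: "l \<in> L \<Longrightarrow> l \<subset> P"
    and line_two_points: "l \<in> L \<Longrightarrow> \<exists>x\<in>l. \<exists>y\<in>l. x \<noteq> y"
    and line_unique: "\<lbrakk>l \<in> L; m \<in> L; x \<in> l; y \<in> l; x \<in> m; y \<in> m; x \<noteq> y\<rbrakk> \<Longrightarrow> l = m"

definition collinear :: "'a set set \<Rightarrow> 'a \<Rightarrow> 'a \<Rightarrow> bool" where
  "collinear L x y \<longleftrightarrow> x = y \<or> (\<exists>l\<in>L. x \<in> l \<and> y \<in> l)"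

definition lin_subspace :: "'a set \<Rightarrow> 'a set set \<Rightarrow> 'a set \<Rightarrow> bool" where
  "lin_subspace P L S \<longleftrightarrow> S \<subseteq> P \<and>
     (\<forall>x\<in>S. \<forall>y\<in>S. \<forall>l\<in>L. x \<noteq> y \<longrightarrow> x \<in> l \<longrightarrow> y \<in> l \<longrightarrow> l \<subseteq> S)"

definition singular_subspace :: "'a set \<Rightarrow> 'a set set \<Rightarrow> 'a set \<Rightarrow> bool" where
  "singular_subspace P L S \<longleftrightarrow> lin_subspace P L S \<and> (\<forall>x\<in>S. \<forall>y\<in>S. collinear L x y)"

definition maximal_singular_subspace :: "'a set \<Rightarrow> 'a set set \<Rightarrow> 'a set \<Rightarrow> bool" where
  "maximal_singular_subspace P L M \<longleftrightarrow> singular_subspace P L M \<and>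
     (\<forall>S. singular_subspace P L S \<longrightarrow> M \<subseteq> S \<longrightarrow> S = M)"

definition perp :: "'a set \<Rightarrow> 'a set set \<Rightarrow> 'a set \<Rightarrow> 'a set" where
  "perp P L X = {p \<in> P. \<forall>x\<in>X. collinear L p x}"

text \<open>The projective dimension of \<open>S\<close> is one less than the least cardinality of a set of
  points spanning \<open>S\<close>; the empty set is spanned by itself and has dimension -1.
  It is a relation, so that an \<open>S\<close> which is not finitely spanned has no dimension at all.\<close>

definition has_pdim :: "'a set \<Rightarrow> 'a set set \<Rightarrow> 'a set \<Rightarrow> int \<Rightarrow> bool" where
  "has_pdim P L S d \<longleftrightarrow>
     (\<exists>B. finite B \<and> lin_subspace P L hull B = S \<and> int (card B) = d + 1) \<and>
     (\<forall>B. finite B \<longrightarrow> lin_subspace P L hull B = S \<longrightarrow> d + 1 \<le> int (card B))"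

text \<open>The last assumption is the Veblen-Young axiom: if the lines \<open>ab\<close> and \<open>cd\<close> meet,
  then so do \<open>ac\<close> and \<open>bd\<close>.\<close>

locale projective_space = partial_linear_space +
  assumes line_three_points:
      "l \<in> L \<Longrightarrow> \<exists>x\<in>l. \<exists>y\<in>l. \<exists>z\<in>l. x \<noteq> y \<and> y \<noteq> z \<and> x \<noteq> z"
    and all_collinear: "\<lbrakk>x \<in> P; y \<in> P\<rbrakk> \<Longrightarrow> collinear L x y"
    and veblen_young:
      "\<lbrakk>distinct [a, b, c, d]; ab \<in> L; cd \<in> L; ac \<in> L; bd \<in> L;
        {a, b} \<subseteq> ab; {c, d} \<subseteq> cd; {a, c} \<subseteq> ac; {b, d} \<subseteq> bd; ab \<inter> cd \<noteq> {}\<rbrakk>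
       \<Longrightarrow> ac \<inter> bd \<noteq> {}"

locale polar_space = partial_linear_space +
  assumes P1: "l \<in> L \<Longrightarrow> \<exists>x\<in>l. \<exists>y\<in>l. \<exists>z\<in>l. x \<noteq> y \<and> y \<noteq> z \<and> x \<noteq> z"
    and P2: "p \<in> P \<Longrightarrow> \<exists>q\<in>P. \<not> collinear L p q"
    and P3: "\<lbrakk>p \<in> P; l \<in> L\<rbrakk> \<Longrightarrow>
        (\<exists>!q. q \<in> l \<and> collinear L p q) \<or> (\<forall>q\<in>l. collinear L p q)"
    and P4: "subset.chain {S. singular_subspace P L S} F \<Longrightarrow> finite F"

text \<open>Intended for \<open>n \<ge> 3\<close>: lines of a partial linear space are proper subsets, so for
  \<open>n = 2\<close> a maximal singular subspace, being a line, would not qualify as a projective space.\<close>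

definition polar_rank :: "'a set \<Rightarrow> 'a set set \<Rightarrow> nat \<Rightarrow> bool" where
  "polar_rank P L n \<longleftrightarrow> (\<forall>M. maximal_singular_subspace P L M \<longrightarrow>
     projective_space M {l \<in> L. l \<subseteq> M} \<and> has_pdim P L M (int n - 1))"

definition polar_grassmannian :: "'a set \<Rightarrow> 'a set set \<Rightarrow> nat \<Rightarrow> 'a set set" where
  "polar_grassmannian P L k = {S. singular_subspace P L S \<and> has_pdim P L S (int k)}"

definition adj11 :: "'a set \<Rightarrow> 'a set set \<Rightarrow> nat \<Rightarrow> 'a set \<Rightarrow> 'a set \<Rightarrow> bool" where
  "adj11 P L k X Y \<longleftrightarrow>
     has_pdim P L (perp P L X \<inter> Y) (int k - 1) \<and> has_pdim P L (X \<inter> Y) (int k - 1)"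

definition graph_automorphism :: "'v set \<Rightarrow> ('v \<Rightarrow> 'v \<Rightarrow> bool) \<Rightarrow> ('v \<Rightarrow> 'v) \<Rightarrow> bool" where
  "graph_automorphism V E f \<longleftrightarrow> bij_betw f V V \<and> (\<forall>x\<in>V. \<forall>y\<in>V. E (f x) (f y) \<longleftrightarrow> E x y)"

definition geometry_automorphism :: "'a set \<Rightarrow> 'a set set \<Rightarrow> ('a \<Rightarrow> 'a) \<Rightarrow> bool" where
  "geometry_automorphism P L \<phi> \<longleftrightarrow> bij_betw \<phi> P P \<and> (\<lambda>l. \<phi> ` l) ` L = L"

end

theory Submission
  imports Defs
begin

text \<open>
  The proof goes down in the dimension \<open>k\<close>. For \<open>k = 0\<close> the graph is the complement of the
  collinearity graph on points, and a line through \<open>x\<close> and \<open>y\<close> is recovered from collinearity as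
  the double perp of \<open>{x, y}\<close> (\<open>line_eq_perp_perp\<close>), so a graph automorphism is a collineation.

  For \<open>k = j + 1\<close>, two \<open>k\<close>-spaces \<open>X\<close> and \<open>Y\<close> are adjacent iff they meet in a \<open>j\<close>-space and are
  not orthogonal. The graph sees more than that: it determines the relation "meeting in a
  \<open>j\<close>-space", orthogonal or not (\<open>rk_Int_iff\<close>). Three \<open>k\<close>-spaces that pairwise meet in
  \<open>j\<close>-spaces, two of them non-orthogonal, all contain one common \<open>j\<close>-space (\<open>triangle\<close>),
  because a proper triangle would span a singular subspace. Hence two non-adjacent spaces with a
  common neighbour fall into two types. If they meet in a \<open>j\<close>-space, all common neighbours contain
  it, and as soon as there are three of them, two are adjacent
  (\<open>orthogonal_pair_adjacent_nbrs\<close>). Otherwise the pair looks like two opposite lines modulo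
  their intersection; the common neighbours are the transversals of these lines: there are at least
  three, and no two are adjacent (\<open>transversal_pair_three_nbrs\<close>,
  \<open>transversal_pair_no_adjacent_nbrs\<close>). The threshold three is needed: in a 3 by 3 grid, which
  can occur as the residue of a \<open>j\<close>-space, two collinear points have exactly two common
  non-neighbours, and these are collinear.

  The star of a \<open>j\<close>-space \<open>S\<close>, the set of \<open>k\<close>-spaces containing it, consists of the spaces that
  equal or meet in a \<open>j\<close>-space each of two adjacent spaces with intersection \<open>S\<close>. So a graph
  automorphism permutes the stars and acts on the \<open>j\<close>-spaces. Adjacency of \<open>j\<close>-spaces can be read
  off from adjacency between the members of their stars (\<open>adj_star_iff\<close>), so this action is a graph
  automorphism one dimension lower, and a space is determined by the \<open>j\<close>-spaces in it.

  All facts on singular subspaces come from one separation property (\<open>separating_point\<close>): a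
  finitely spanned singular subspace is its own double perp. It yields the exchange property, hence
  a rank, and it presents hyperplanes of singular subspaces as intersections with perps of points, so
  that the one-or-all axiom makes every line meet them.
\<close>

section \<open>Collinearity\<close>

context polar_space
begin

abbreviation col :: "'a \<Rightarrow> 'a \<Rightarrow> bool" (infix "\<sim>" 50) where
  "x \<sim> y \<equiv> collinear L x y"

abbreviation span :: "'a set \<Rightarrow> 'a set" where
  "span B \<equiv> lin_subspace P L hull B"

abbreviation singular :: "'a set \<Rightarrow> bool" where
  "singular S \<equiv> singular_subspace P L S"

definition orth :: "'a set \<Rightarrow> 'a set \<Rightarrow> bool" where
  "orth A B \<longleftrightarrow> (\<forall>a\<in>A. \<forall>b\<in>B. a \<sim> b)"

lemma line_point: "\<lbrakk>l \<in> L; x \<in> l\<rbrakk> \<Longrightarrow> x \<in> P"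
  using line_proper by blast

lemma col_refl [simp]: "x \<sim> x"
  by (simp add: collinear_def)

lemma col_sym: "x \<sim> y \<longleftrightarrow> y \<sim> x"
  by (auto simp: collinear_def)

lemma on_line_col: "\<lbrakk>l \<in> L; x \<in> l; y \<in> l\<rbrakk> \<Longrightarrow> x \<sim> y"
  by (auto simp: collinear_def)

lemma join: "\<lbrakk>x \<sim> y; x \<noteq> y\<rbrakk> \<Longrightarrow> \<exists>l\<in>L. x \<in> l \<and> y \<in> l"
  by (auto simp: collinear_def)

lemma col_point: "\<lbrakk>x \<sim> y; y \<in> P\<rbrakk> \<Longrightarrow> x \<in> P"
  using line_point by (auto simp: collinear_def)

lemma col_all:
  assumes "l \<in> L" "x \<in> l" "y \<in> l" "x \<noteq> y" "p \<sim> x" "p \<sim> y" "z \<in> l"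
  shows "p \<sim> z"
proof -
  have "p \<in> P" using assms line_point col_point by blast
  then show ?thesis using P3[of p l] assms by blast
qed

lemma col_all':
  assumes "l \<in> L" "x \<in> l" "y \<in> l" "x \<noteq> y" "x \<sim> p" "y \<sim> p" "z \<in> l"
  shows "z \<sim> p"
  using col_all[of l x y p z] assms by (simp add: col_sym[of _ p])

lemma col_some: "\<lbrakk>p \<in> P; l \<in> L\<rbrakk> \<Longrightarrow> \<exists>q\<in>l. p \<sim> q"
  using P3[of p l] line_two_points[of l] by metis

lemma third_point: "l \<in> L \<Longrightarrow> \<exists>w\<in>l. w \<noteq> x \<and> w \<noteq> y"
  using P1[of l] by metis


section \<open>Spans and orthogonality\<close>

lemma subspace_line:
  "\<lbrakk>lin_subspace P L S; x \<in> S; y \<in> S; x \<noteq> y; l \<in> L; x \<in> l; y \<in> l\<rbrakk> \<Longrightarrow> l \<subseteq> S"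
  by (auto simp: lin_subspace_def)

lemma subspace_points: "lin_subspace P L S \<Longrightarrow> S \<subseteq> P"
  by (auto simp: lin_subspace_def)

lemma subspace_all: "lin_subspace P L P"
  using line_proper by (auto simp: lin_subspace_def)

lemma subspace_Int:
  "\<lbrakk>lin_subspace P L S; lin_subspace P L T\<rbrakk> \<Longrightarrow> lin_subspace P L (S \<inter> T)"
  using subspace_line[of S] subspace_line[of T] subspace_points[of S]
  unfolding lin_subspace_def by (metis Int_iff le_infI le_infI1)

lemma subspace_perp: "lin_subspace P L {p \<in> P. \<forall>x\<in>X. p \<sim> x}"
  unfolding lin_subspace_def
proof (intro conjI ballI impI subsetI)
  fix x y l z
  assume "x \<in> {p \<in> P. \<forall>x\<in>X. p \<sim> x}" "y \<in> {p \<in> P. \<forall>x\<in>X. p \<sim> x}" "l \<in> L" "x \<noteq> y"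
    "x \<in> l" "y \<in> l" "z \<in> l"
  moreover have "a \<sim> z" if "a \<in> X" for a
    using calculation that col_all[of l x y a z] col_sym[of a] by simp
  ultimately show "z \<in> {p \<in> P. \<forall>x\<in>X. p \<sim> x}"
    using line_point col_sym[of z] by simp
qed auto

lemma span_subset: "B \<subseteq> span B"
  by (rule hull_subset)

lemma span_least: "\<lbrakk>B \<subseteq> S; lin_subspace P L S\<rbrakk> \<Longrightarrow> span B \<subseteq> S"
  by (rule hull_minimal)

lemma span_mono: "A \<subseteq> B \<Longrightarrow> span A \<subseteq> span B"
  by (rule hull_mono)

lemma span_subspace:
  assumes "B \<subseteq> P"
  shows "lin_subspace P L (span B)"
proof -
  have "span B \<subseteq> P" using assms subspace_all by (rule hull_minimal)
  moreover have "l \<subseteq> span B"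
    if "x \<in> span B" "y \<in> span B" "l \<in> L" "x \<noteq> y" "x \<in> l" "y \<in> l" for x y l
  proof -
    have "l \<subseteq> S" if "lin_subspace P L S" "B \<subseteq> S" for S
      using that \<open>x \<in> span B\<close> \<open>y \<in> span B\<close> \<open>l \<in> L\<close> \<open>x \<noteq> y\<close> \<open>x \<in> l\<close> \<open>y \<in> l\<close>
        span_least[OF that(2,1)] subspace_line[of S x y l] by blast
    then show ?thesis by (auto simp: hull_def)
  qed
  ultimately show ?thesis by (auto simp: lin_subspace_def)
qed

lemma span_eq: "lin_subspace P L S \<Longrightarrow> span S = S"
  by (simp add: hull_same)

lemma span_empty: "span {} = {}"
  by (rule span_eq) (simp add: lin_subspace_def)

lemma span_span_insert:
  assumes "B \<subseteq> P" "p \<in> P"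
  shows "span (insert p (span B)) = span (insert p B)"
proof
  have "lin_subspace P L (span (insert p B))" using assms span_subspace by simp
  moreover have "span B \<subseteq> span (insert p B)" by (rule span_mono) blast
  ultimately show "span (insert p (span B)) \<subseteq> span (insert p B)"
    using span_subset[of "insert p B"] by (intro span_least) auto
  show "span (insert p B) \<subseteq> span (insert p (span B))"
    using span_subset[of B] by (intro span_mono) blast
qed

lemma orth_sym: "orth A B \<longleftrightarrow> orth B A"
  unfolding orth_def using col_sym by blast

lemma orth_span:
  assumes "orth A B" "B \<subseteq> P"
  shows "orth A (span B)"
proof -
  have "B \<subseteq> {p \<in> P. \<forall>x\<in>A. p \<sim> x}" using assms col_sym unfolding orth_def by blast
  then have "span B \<subseteq> {p \<in> P. \<forall>x\<in>A. p \<sim> x}" using subspace_perp span_least by blast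
  then show ?thesis unfolding orth_def using col_sym by blast
qed

lemma col_span: "\<lbrakk>\<forall>b\<in>B. q \<sim> b; B \<subseteq> P; x \<in> span B\<rbrakk> \<Longrightarrow> q \<sim> x"
  using orth_span[of "{q}" B] unfolding orth_def by blast

lemma orth_span_span:
  "\<lbrakk>orth A B; A \<subseteq> P; B \<subseteq> P\<rbrakk> \<Longrightarrow> orth (span A) (span B)"
  using orth_span[of A B] orth_span[of "span B" A] orth_sym by metis

lemma span_singular:
  assumes "orth B B" "B \<subseteq> P"
  shows "singular (span B)"
proof -
  have "orth (span B) (span B)" using assms orth_span orth_sym by blast
  then show ?thesis using span_subspace assms unfolding singular_subspace_def orth_def by blast
qed

lemma singular_subspace: "singular S \<Longrightarrow> lin_subspace P L S"
  and singular_orth: "singular S \<Longrightarrow> orth S S"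
  and singular_points: "singular S \<Longrightarrow> S \<subseteq> P"
  by (auto simp: singular_subspace_def orth_def lin_subspace_def)

lemma singular_sub:
  "\<lbrakk>singular S; lin_subspace P L T; T \<subseteq> S\<rbrakk> \<Longrightarrow> singular T"
  unfolding singular_subspace_def by blast

lemma singular_Int: "\<lbrakk>singular S; singular T\<rbrakk> \<Longrightarrow> singular (S \<inter> T)"
  using singular_sub[of S "S \<inter> T"] subspace_Int singular_subspace by blast

lemma singular_insert:
  assumes "singular S" "p \<in> P" "\<forall>s\<in>S. p \<sim> s"
  shows "singular (span (insert p S))"
  using assms singular_orth[of S] singular_points[of S] col_sym
  by (intro span_singular) (auto simp: orth_def)

section \<open>Separation and exchange\<close>

text \<open>  Induction on \<open>B\<close>. If \<open>p\<close> is not collinear to some generator, that generator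
  will do. Otherwise, in the step from \<open>B\<close> to \<open>insert a B\<close>, let \<open>l\<close> be the line joining \<open>a\<close> and \<open>p\<close>;
  it lies in the perp of \<open>B\<close>, and only \<open>a\<close> can lie in the span of \<open>B\<close>. The point sought is one in
  the perp of \<open>B\<close> whose only neighbour on \<open>l\<close> is \<open>a\<close>. If the induction hypothesis does not give it
  directly, it gives points \<open>q\<close> and \<open>q'\<close> whose only neighbours on \<open>l\<close> are distinct points \<open>w\<close> and \<open>w'\<close>.
  From these one gets a line \<open>h\<close> in the perp of \<open>B\<close>, two of whose points have different single
  neighbours on \<open>l\<close>. The point of \<open>h\<close> collinear to \<open>a\<close> then cannot be collinear to all of \<open>l\<close>.\<close>

lemma separating_point:
  assumes "finite B" "orth B B" "B \<subseteq> P" "p \<in> P" "p \<notin> span B"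
  shows "\<exists>q\<in>P. (\<forall>b\<in>B. q \<sim> b) \<and> \<not> q \<sim> p"
  using assms
proof (induction B arbitrary: p rule: finite_induct)
  case empty
  then show ?case using P2 col_sym by blast
next
  case (insert a B)
  have B: "orth B B" "B \<subseteq> P" "a \<in> P" and aB: "\<forall>b\<in>B. a \<sim> b"
    using insert.prems by (auto simp: orth_def)
  have sub: "lin_subspace P L (span (insert a B))"
    using insert.prems span_subspace by blast
  have a_in: "a \<in> span (insert a B)" using span_subset[of "insert a B"] by blast
  have spB: "span B \<subseteq> span (insert a B)" by (rule span_mono) blast
  show ?case
  proof (cases "\<forall>b\<in>insert a B. p \<sim> b")
    case False
    then show ?thesis using insert.prems unfolding orth_def using col_sym by blast
  next
    case True
    then have pB: "\<forall>b\<in>B. p \<sim> b" and "p \<sim> a" by auto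
    have "p \<noteq> a" using insert.prems a_in by blast
    with \<open>p \<sim> a\<close> obtain l where l: "l \<in> L" "p \<in> l" "a \<in> l" using join by blast
    have lB: "b \<sim> y" if "b \<in> B" "y \<in> l" for b y
      using col_all[of l a p b y] l that aB pB \<open>p \<noteq> a\<close> col_sym by blast
    have l_out: "y \<notin> span B" if "y \<in> l" "y \<noteq> a" for y
      using subspace_line[OF sub _ a_in that(2) l(1) that(1) l(3)] spB l(2) insert.prems(4) by blast
    show ?thesis
    proof (rule ccontr)
      assume neg: "\<not> ?thesis"
      have good: "q \<sim> p" if "q \<in> P" "\<forall>b\<in>B. q \<sim> b" "q \<sim> a" for q using neg that by blast
      have good': "q \<sim> y" if "q \<in> P" "\<forall>b\<in>B. q \<sim> b" "q \<sim> a" "y \<in> l" for q y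
        using col_all[OF l(1,2,3) \<open>p \<noteq> a\<close> good[OF that(1-3)] that(3,4)] .
      obtain q where q: "q \<in> P" "\<forall>b\<in>B. q \<sim> b" "\<not> q \<sim> p"
        using insert.IH[of p] B insert.prems spB by blast
      obtain w where w: "w \<in> l" "q \<sim> w" using col_some[OF q(1) l(1)] by blast
      have "w \<noteq> a" "w \<noteq> p" using good q w by auto
      obtain q' where q': "q' \<in> P" "\<forall>b\<in>B. q' \<sim> b" "\<not> q' \<sim> w"
        using insert.IH[of w] B l_out[OF w(1) \<open>w \<noteq> a\<close>] line_point[OF l(1) w(1)] by blast
      obtain w' where w': "w' \<in> l" "q' \<sim> w'" using col_some[OF q'(1) l(1)] by blast
      have "w' \<noteq> w" using q' w' by auto
      have "w \<noteq> q" using q l w on_line_col by blast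
      then obtain m where m: "m \<in> L" "q \<in> m" "w \<in> m" using join w by blast
      obtain r where r: "r \<in> m" "q' \<sim> r" using col_some[OF q'(1) m(1)] by blast
      have "r \<noteq> w" using r q' by auto
      have mB: "b \<sim> y" if "b \<in> B" "y \<in> m" for b y
        using col_all[of m q w b y] m that q(2) lB[OF _ w(1)] \<open>w \<noteq> q\<close> col_sym by blast
      \<comment> \<open>The line \<open>h\<close> below joins \<open>r\<close>, whose only neighbour on \<open>l\<close> is \<open>w\<close>, to \<open>q'\<close>.\<close>
      have r_line: "y = w" if "y \<in> l" "r \<sim> y" for y
      proof (rule ccontr)
        assume "y \<noteq> w"
        then have "r \<sim> p"
          using col_all[of l y w r p] l w that on_line_col[OF m(1) r(1) m(3)] by blast
        then show False
          using col_all[of m r w p q] m r \<open>r \<noteq> w\<close> on_line_col[OF l(1,2) w(1)] q col_sym by blast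
      qed
      have "r \<noteq> q'" using q' on_line_col[OF m(1) r(1) m(3)] by auto
      then obtain h where h: "h \<in> L" "r \<in> h" "q' \<in> h" using join r col_sym by blast
      have hB: "b \<sim> y" if "b \<in> B" "y \<in> h" for b y
        using col_all[of h r q' b y] h that mB[OF _ r(1)] q'(2) \<open>r \<noteq> q'\<close> col_sym by blast
      obtain t where t: "t \<in> h" "a \<sim> t" using col_some[OF \<open>a \<in> P\<close> h(1)] by blast
      have tl: "t \<sim> y" if "y \<in> l" for y
        using good'[of t y] t hB line_point[OF h(1) t(1)] that col_sym by blast
      have "t \<noteq> r" using r_line[OF w'(1)] tl[OF w'(1)] \<open>w' \<noteq> w\<close> by blast
      moreover have "w \<sim> r" "w \<sim> t"
        using on_line_col[OF m(1) m(3) r(1)] tl[OF w(1)] col_sym by auto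
      ultimately have "w \<sim> q'" using col_all[of h t r w q'] h t by blast
      then show False using q' col_sym by blast
    qed
  qed
qed

text \<open>  Otherwise \<open>B\<close> and \<open>c\<close> have a common perp point \<open>q\<close> not collinear to \<open>a\<close>. A point \<open>r'\<close> in the perp
  of \<open>B\<close>, collinear to \<open>q\<close> but not to \<open>c\<close>, yields a line through \<open>q\<close> whose point \<open>t\<close> collinear to \<open>a\<close> is
  not collinear to \<open>c\<close>. But \<open>t\<close> is in the perp of \<open>insert a B\<close>, whose span contains \<open>c\<close>.\<close>

lemma exchange:
  assumes fin: "finite B" and "orth (insert a B) (insert a B)" "insert a B \<subseteq> P"
    and c: "c \<in> span (insert a B)" "c \<notin> span B"
  shows "a \<in> span (insert c B)"
proof (rule ccontr)
  assume a: "a \<notin> span (insert c B)"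
  have B: "orth B B" "B \<subseteq> P" "a \<in> P" and aB: "\<forall>b\<in>B. a \<sim> b"
    using assms by (auto simp: orth_def)
  have S: "singular (span (insert a B))" using assms span_singular by blast
  have spB: "B \<subseteq> span (insert a B)" and a_in: "a \<in> span (insert a B)"
    using span_subset[of "insert a B"] by auto
  have S_col: "x \<sim> y" if "x \<in> span (insert a B)" "y \<in> span (insert a B)" for x y
    using singular_orth[OF S] that unfolding orth_def by blast
  have "c \<in> P" using singular_points[OF S] c by blast
  have c_perp: "q \<sim> c" if "\<forall>b\<in>B. q \<sim> b" "q \<sim> a" for q
    using col_span[of "insert a B" q c] that assms by blast
  have orthc: "orth (insert c B) (insert c B)"
    unfolding orth_def using S_col spB c by blast
  obtain q where q: "q \<in> P" "\<forall>b\<in>B. q \<sim> b" "q \<sim> c" "\<not> q \<sim> a"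
    using separating_point[of "insert c B" a] fin orthc B \<open>c \<in> P\<close> a by auto
  obtain r where r: "r \<in> P" "\<forall>b\<in>B. r \<sim> b" "\<not> r \<sim> c"
    using separating_point[of B c] fin B \<open>c \<in> P\<close> c by auto
  have "a \<noteq> c" using q by auto
  obtain l where l: "l \<in> L" "a \<in> l" "c \<in> l" using join[OF S_col \<open>a \<noteq> c\<close>] a_in c by blast
  have l_in: "l \<subseteq> span (insert a B)"
    using subspace_line[OF singular_subspace[OF S] a_in c(1) \<open>a \<noteq> c\<close> l] .
  obtain w where w: "w \<in> l" "r \<sim> w" using col_some[OF r(1) l(1)] by blast
  have "w \<noteq> c" using r w by auto
  have "\<not> q \<sim> w" using col_all[of l w c q a] l w \<open>w \<noteq> c\<close> q by blast
  have "r \<noteq> w" using r l w on_line_col by blast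
  then obtain m where m: "m \<in> L" "r \<in> m" "w \<in> m" using join w by blast
  obtain r' where r': "r' \<in> m" "q \<sim> r'" using col_some[OF q(1) m(1)] by blast
  have "r' \<noteq> w" using r' \<open>\<not> q \<sim> w\<close> by auto
  have wB: "w \<sim> b" if "b \<in> B" for b using S_col l_in w spB that by blast
  have r'B: "b \<sim> r'" if "b \<in> B" for b
    using col_all[of m r w b r'] m r' wB[OF that] r(2) that \<open>r \<noteq> w\<close> col_sym by blast
  have r'c: "\<not> c \<sim> r'"
  proof
    assume "c \<sim> r'"
    then have "c \<sim> r" using col_all[of m r' w c r] m r' \<open>r' \<noteq> w\<close> on_line_col[OF l(1,3) w(1)] by blast
    then show False using r col_sym by blast
  qed
  have "q \<noteq> r'" using r'c q col_sym by blast
  then obtain h where h: "h \<in> L" "q \<in> h" "r' \<in> h" using join r' by blast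
  obtain t where t: "t \<in> h" "a \<sim> t" using col_some[OF B(3) h(1)] by blast
  have "t \<noteq> q" using t q col_sym by blast
  have "b \<sim> t" if "b \<in> B" for b
    using col_all[of h q r' b t] h t r'B[OF that] q(2) that \<open>q \<noteq> r'\<close> col_sym by blast
  then have "c \<sim> t" using c_perp[of t] t col_sym by blast
  then have "c \<sim> r'" using col_all[of h t q c r'] h t \<open>t \<noteq> q\<close> q(3) col_sym by blast
  with r'c show False ..
qed

section \<open>Rank\<close>

definition indep :: "'a set \<Rightarrow> bool" where
  "indep B \<longleftrightarrow> finite B \<and> orth B B \<and> B \<subseteq> P \<and> (\<forall>b\<in>B. b \<notin> span (B - {b}))"

text \<open>  The projective dimension plus one, for subspaces that have a dimension.\<close>

definition rk :: "'a set \<Rightarrow> nat" where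
  "rk S = (LEAST m. \<exists>B. finite B \<and> span B = S \<and> card B = m)"

lemma indep_insert:
  assumes "indep B" "p \<in> P" "\<forall>b\<in>B. p \<sim> b" "p \<notin> span B"
  shows "indep (insert p B)"
proof -
  have B: "finite B" "orth B B" "B \<subseteq> P" "\<And>b. b \<in> B \<Longrightarrow> b \<notin> span (B - {b})"
    using assms(1) by (auto simp: indep_def)
  have "p \<notin> B" using assms(4) span_subset by blast
  have o: "orth (insert p B) (insert p B)" using B assms col_sym by (auto simp: orth_def)
  have "b \<notin> span (insert p B - {b})" if "b \<in> insert p B" for b
  proof
    assume *: "b \<in> span (insert p B - {b})"
    have "b \<noteq> p" using * assms(4) \<open>p \<notin> B\<close> by auto
    then have "b \<in> B" and eq: "insert p B - {b} = insert p (B - {b})" using that by auto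
    have "p \<in> span (insert b (B - {b}))"
      using exchange[of "B - {b}" p b] * eq B \<open>b \<in> B\<close> o assms(2) by (auto simp: orth_def)
    then show False using assms(4) \<open>b \<in> B\<close> by (simp add: insert_absorb)
  qed
  then show ?thesis using B o assms(2) by (simp add: indep_def)
qed

lemma indep_subset: "\<lbrakk>indep B; C \<subseteq> B\<rbrakk> \<Longrightarrow> indep C"
proof -
  assume *: "indep B" "C \<subseteq> B"
  have "span (C - {b}) \<subseteq> span (B - {b})" for b using *(2) by (intro span_mono) blast
  then show "indep C" using * finite_subset[of C B] unfolding indep_def orth_def by blast
qed

text \<open>  Steinitz exchange: a member of \<open>C\<close> outside \<open>B\<close> can be traded for one of \<open>B\<close> without losing
  independence, until \<open>C\<close> is a subset of \<open>B\<close>.\<close>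

lemma indep_card_le:
  assumes "finite B" "orth B B" "B \<subseteq> P" "indep C" "C \<subseteq> span B"
  shows "card C \<le> card B"
  using assms(4,5)
proof (induction "card (C - B)" arbitrary: C rule: less_induct)
  case less
  have S: "singular (span B)" using span_singular assms by blast
  have C: "finite C" using less.prems by (simp add: indep_def)
  show ?case
  proof (cases "C \<subseteq> B")
    case True
    then show ?thesis using assms(1) by (simp add: card_mono)
  next
    case False
    then obtain c where c: "c \<in> C" "c \<notin> B" by blast
    have "c \<notin> span (C - {c})" using less.prems c by (simp add: indep_def)
    moreover have "lin_subspace P L (span (C - {c}))"
      using less.prems by (intro span_subspace) (auto simp: indep_def)
    ultimately have "\<not> B \<subseteq> span (C - {c})"
      using span_least[of B "span (C - {c})"] less.prems(2) c by blast
    then obtain b where b: "b \<in> B" "b \<notin> span (C - {c})" by blast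
    let ?C = "insert b (C - {c})"
    have "b \<in> span B" using b span_subset by blast
    then have "indep ?C"
      using less.prems b assms(3) singular_orth[OF S]
      by (intro indep_insert indep_subset[OF less.prems(1)]) (auto simp: orth_def)
    moreover have "?C \<subseteq> span B" using less.prems(2) \<open>b \<in> span B\<close> by (simp add: subset_iff)
    moreover have "?C - B \<subset> C - B" using b(1) c by (simp add: psubset_eq subset_iff set_eq_iff) metis
    then have "card (?C - B) < card (C - B)" using C by (intro psubset_card_mono) auto
    ultimately have "card ?C \<le> card B" using less.hyps by blast
    moreover have "b \<notin> C - {c}" using b span_subset[of "C - {c}"] by blast
    then have "card ?C = card C" using C c by (metis card.remove card_insert_disjoint finite_Diff)
    ultimately show ?thesis by simp
  qed
qed

lemma rk_span:
  assumes "indep B"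
  shows "rk (span B) = card B"
  unfolding rk_def
proof (rule Least_equality)
  show "\<exists>C. finite C \<and> span C = span B \<and> card C = card B"
    using assms by (auto simp: indep_def)
  fix m assume "\<exists>C. finite C \<and> span C = span B \<and> card C = m"
  then obtain C where C: "finite C" "span C = span B" "card C = m" by blast
  have "singular (span B)" using assms by (intro span_singular) (auto simp: indep_def)
  moreover have "C \<subseteq> span B" using C span_subset[of C] by simp
  ultimately have "orth C C" "C \<subseteq> P"
    using singular_orth[of "span B"] singular_points[of "span B"] by (auto simp: orth_def)
  then show "card B \<le> m"
    using indep_card_le[of C B] assms C span_subset[of B] by simp
qed

end

locale ranked_polar_space = polar_space +
  fixes n :: nat
  assumes rank: "polar_rank P L n" and rank_ge: "3 \<le> n"
begin

lemma maximal_exists: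
  assumes "singular S"
  shows "\<exists>M. maximal_singular_subspace P L M \<and> S \<subseteq> M"
proof -
  let ?A = "{T. singular T \<and> S \<subseteq> T}"
  have "\<exists>M\<in>?A. \<forall>X\<in>?A. M \<subseteq> X \<longrightarrow> X = M"
  proof (rule subset_Zorn)
    fix C assume C: "subset.chain ?A C"
    then have "C \<subseteq> ?A" by (simp add: subset.chain_def)
    have "subset.chain {T. singular T} C"
      using C by (auto simp: subset.chain_def)
    then have fin: "finite C" by (rule P4)
    show "\<exists>U\<in>?A. \<forall>X\<in>C. X \<subseteq> U"
    proof (cases "C = {}")
      case True
      then show ?thesis using assms by blast
    next
      case False
      then have "\<Union>C \<in> C" using fin C by (intro Union_in_chain)
      then show ?thesis using \<open>C \<subseteq> ?A\<close> by blast
    qed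
  qed
  then obtain M where M: "M \<in> ?A" and max: "\<forall>X\<in>?A. M \<subseteq> X \<longrightarrow> X = M" by (rule bexE)
  have "X = M" if "singular X" "M \<subseteq> X" for X
    using max M that subset_trans[of S M X] by simp
  then have "maximal_singular_subspace P L M"
    using M unfolding maximal_singular_subspace_def by simp
  with M show ?thesis by blast
qed

lemma maximal_spanned:
  assumes "maximal_singular_subspace P L M"
  shows "\<exists>B. finite B \<and> span B = M \<and> card B = n"
  using assms rank unfolding polar_rank_def has_pdim_def by fastforce

text \<open>  A maximal singular subspace is finitely spanned, which bounds the independent subsets of \<open>S\<close>; a
  largest one spans \<open>S\<close>.\<close>

lemma basis_exists:
  assumes S: "singular S"
  shows "\<exists>B. indep B \<and> span B = S"
proof -
  obtain M where M: "maximal_singular_subspace P L M" "S \<subseteq> M" using maximal_exists S by blast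
  obtain C where C: "finite C" "span C = M" using maximal_spanned[OF M(1)] by blast
  have "singular M" using M by (simp add: maximal_singular_subspace_def)
  then have "orth C C" "C \<subseteq> P"
    using C span_subset[of C] singular_orth[of M] singular_points[of M] by (auto simp: orth_def)
  then have bound: "card B \<le> card C" if "indep B" "B \<subseteq> S" for B
    using indep_card_le[of C B] that C M by blast
  have "indep {} \<and> {} \<subseteq> S" by (simp add: indep_def orth_def)
  moreover have "\<forall>B. indep B \<and> B \<subseteq> S \<longrightarrow> card B < Suc (card C)" using bound by (simp add: less_Suc_eq_le)
  ultimately have "\<exists>B. (indep B \<and> B \<subseteq> S) \<and> (\<forall>B'. indep B' \<and> B' \<subseteq> S \<longrightarrow> card B' \<le> card B)"
    by (rule ex_has_greatest_nat)
  then obtain B where B: "indep B" "B \<subseteq> S" and max: "\<And>B'. \<lbrakk>indep B'; B' \<subseteq> S\<rbrakk> \<Longrightarrow> card B' \<le> card B"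
    by blast
  have "span B = S"
  proof
    show "span B \<subseteq> S" using B S singular_subspace span_least by blast
    show "S \<subseteq> span B"
    proof (rule ccontr)
      assume "\<not> S \<subseteq> span B"
      then obtain p where p: "p \<in> S" "p \<notin> span B" by blast
      then have "indep (insert p B)"
        using B singular_orth[OF S] singular_points[OF S]
        by (intro indep_insert) (auto simp: orth_def)
      then have "card (insert p B) \<le> card B" using max[of "insert p B"] B p by blast
      moreover have "p \<notin> B" "finite B" using p span_subset[of B] B by (auto simp: indep_def)
      ultimately show False by simp
    qed
  qed
  then show ?thesis using B by blast
qed

lemma has_pdim_iff_rk:
  assumes "singular S"
  shows "has_pdim P L S d \<longleftrightarrow> int (rk S) = d + 1"
proof -
  obtain B where B: "indep B" "span B = S" using basis_exists assms by blast
  then have *: "rk S = card B" using rk_span by blast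
  have "finite B" using B by (simp add: indep_def)
  have least: "card B \<le> card C" if "finite C" "span C = S" for C
    using * that unfolding rk_def by (metis (mono_tags, lifting) Least_le)
  show ?thesis
  proof
    assume "has_pdim P L S d"
    then obtain C where "finite C" "span C = S" "int (card C) = d + 1" "d + 1 \<le> int (card B)"
      using B \<open>finite B\<close> unfolding has_pdim_def by blast
    then show "int (rk S) = d + 1" using least[of C] * by simp
  next
    assume "int (rk S) = d + 1"
    then show "has_pdim P L S d"
      using B \<open>finite B\<close> least * unfolding has_pdim_def by force
  qed
qed

lemma rk_maximal: "maximal_singular_subspace P L M \<Longrightarrow> rk M = n"
  using rank has_pdim_iff_rk[of M "int n - 1"]
  unfolding polar_rank_def maximal_singular_subspace_def by auto

lemma rk_insert:
  assumes "singular S" "p \<in> P" "\<forall>s\<in>S. p \<sim> s" "p \<notin> S"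
  shows "rk (span (insert p S)) = Suc (rk S)"
proof -
  obtain B where B: "indep B" "span B = S" using basis_exists assms by blast
  have "B \<subseteq> S" using B span_subset by blast
  then have "indep (insert p B)" using B assms by (intro indep_insert) auto
  moreover have "span (insert p S) = span (insert p B)"
    using span_span_insert[of B p] B assms by (simp add: indep_def)
  moreover have "p \<notin> B" "finite B" using B \<open>B \<subseteq> S\<close> assms by (auto simp: indep_def)
  ultimately show ?thesis using rk_span[of B] rk_span[of "insert p B"] B by simp
qed

lemma rk_strict_mono:
  assumes "singular U" "singular S" "S \<subset> U"
  shows "rk S < rk U"
proof -
  obtain p where p: "p \<in> U" "p \<notin> S" using assms by blast
  obtain B where B: "indep B" "span B = S" using basis_exists assms by blast
  obtain C where C: "indep C" "span C = U" using basis_exists assms by blast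
  have "B \<subseteq> S" using B span_subset by blast
  have o: "\<forall>s\<in>S. p \<sim> s" "p \<in> P"
    using p assms singular_orth[of U] singular_points[of U] by (auto simp: orth_def)
  have "indep (insert p B)" using B p o \<open>B \<subseteq> S\<close> by (intro indep_insert) auto
  then have "card (insert p B) \<le> card C"
    using C p \<open>B \<subseteq> S\<close> assms(3) by (intro indep_card_le) (auto simp: indep_def)
  moreover have "p \<notin> B" "finite B" using B \<open>B \<subseteq> S\<close> p by (auto simp: indep_def)
  ultimately show ?thesis using B C rk_span by fastforce
qed

lemma rk_mono: "\<lbrakk>singular U; singular S; S \<subseteq> U\<rbrakk> \<Longrightarrow> rk S \<le> rk U"
  using rk_strict_mono[of U S] by (cases "S = U") (auto simp: psubset_eq)

lemma rk_subset_eq: "\<lbrakk>singular U; singular S; S \<subseteq> U; rk U \<le> rk S\<rbrakk> \<Longrightarrow> S = U"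
  using rk_strict_mono[of U S] by auto

lemma rk_empty: "rk {} = 0"
  using rk_span[of "{}"] by (simp add: span_empty indep_def orth_def)

lemma singular_empty: "singular {}"
  by (simp add: singular_subspace_def lin_subspace_def)

lemma singular_point: "p \<in> P \<Longrightarrow> singular {p}"
  by (simp add: singular_subspace_def lin_subspace_def)

lemma rk_point: "p \<in> P \<Longrightarrow> rk {p} = 1"
  using rk_insert[of "{}" p] singular_empty rk_empty span_eq[of "{p}"] singular_subspace[OF singular_point]
  by simp

lemma singular_line: "l \<in> L \<Longrightarrow> singular l"
  using line_point line_unique[of l] on_line_col[of l]
  unfolding singular_subspace_def lin_subspace_def by (simp add: subset_iff) metis

lemma line_span:
  assumes "l \<in> L" "x \<in> l" "y \<in> l" "x \<noteq> y"
  shows "span {x, y} = l"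
proof
  show "span {x, y} \<subseteq> l"
    using assms singular_subspace[OF singular_line] by (intro span_least) auto
  have "{x, y} \<subseteq> P" using assms line_point by blast
  then show "l \<subseteq> span {x, y}"
    using subspace_line[OF span_subspace, of "{x, y}" x y l] assms span_subset[of "{x, y}"] by blast
qed

lemma rk_line: "l \<in> L \<Longrightarrow> rk l = 2"
proof -
  assume l: "l \<in> L"
  obtain x y where xy: "x \<in> l" "y \<in> l" "x \<noteq> y" using line_two_points[OF l] by blast
  have "x \<sim> y" using on_line_col l xy by blast
  then show ?thesis
    using rk_insert[of "{y}" x] singular_point[of y] rk_point[of y] line_span[OF l xy] l xy line_point
    by simp
qed

lemma span_insert_eq:
  assumes "singular U" "singular S" "S \<subseteq> U" "rk U = Suc (rk S)" "p \<in> U" "p \<notin> S"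
  shows "span (insert p S) = U"
proof -
  have o: "\<forall>s\<in>S. p \<sim> s" "p \<in> P"
    using assms singular_orth[of U] singular_points[of U] by (auto simp: orth_def)
  have "span (insert p S) \<subseteq> U" using assms singular_subspace by (intro span_least) auto
  then show ?thesis
    using rk_subset_eq[of U "span (insert p S)"] rk_insert[OF assms(2) o(2,1) assms(6)]
      singular_insert[OF assms(2) o(2,1)] assms by simp
qed

lemma extend:
  assumes "singular S" "rk S < n"
  shows "\<exists>p\<in>P. (\<forall>s\<in>S. p \<sim> s) \<and> p \<notin> S"
proof -
  obtain M where M: "maximal_singular_subspace P L M" "S \<subseteq> M" using maximal_exists assms by blast
  have "singular M" using M by (simp add: maximal_singular_subspace_def)
  moreover obtain p where "p \<in> M" "p \<notin> S"
    using M(2) assms(2) rk_maximal[OF M(1)] by (cases "S = M") auto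
  ultimately show ?thesis
    using M singular_orth[of M] singular_points[of M] unfolding orth_def by blast
qed

lemma intermediate_subspace:
  assumes X: "singular X" and S: "singular S" "S \<subseteq> X" and "rk S \<le> m" "m \<le> rk X"
  shows "\<exists>T. singular T \<and> S \<subseteq> T \<and> T \<subseteq> X \<and> rk T = m"
  using assms(4,5)
proof (induction m rule: dec_induct)
  case base
  then show ?case using S by blast
next
  case (step m)
  then obtain T where T: "singular T" "S \<subseteq> T" "T \<subseteq> X" "rk T = m" by auto
  then obtain p where p: "p \<in> X" "p \<notin> T" using step.prems by (metis Suc_n_not_le_n subsetI subset_antisym)
  have o: "p \<in> P" "\<forall>s\<in>T. p \<sim> s"
    using p T singular_orth[OF X] singular_points[OF X] unfolding orth_def by auto
  have "span (insert p T) \<subseteq> X" using p T singular_subspace[OF X] by (intro span_least) auto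
  moreover have "T \<subseteq> span (insert p T)" using span_subset[of "insert p T"] by blast
  ultimately show ?case
    using singular_insert[OF T(1) o] rk_insert[OF T(1) o p(2)] T by blast
qed

section \<open>Hyperplanes of singular subspaces\<close>

lemma separate:
  assumes "singular S" "p \<in> P" "p \<notin> S"
  shows "\<exists>q\<in>P. (\<forall>s\<in>S. q \<sim> s) \<and> \<not> q \<sim> p"
proof -
  obtain B where B: "indep B" "span B = S" using basis_exists assms by blast
  then obtain q where "q \<in> P" "\<forall>b\<in>B. q \<sim> b" "\<not> q \<sim> p"
    using separating_point[of B p] assms by (auto simp: indep_def)
  then show ?thesis using col_span[of B q] B by (auto simp: indep_def)
qed

lemma noncollinear_pair:
  assumes "singular S" "rk S < n"
  shows "\<exists>p\<in>P. \<exists>q\<in>P. (\<forall>s\<in>S. p \<sim> s) \<and> (\<forall>s\<in>S. q \<sim> s) \<and> \<not> p \<sim> q"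
  using extend[OF assms] separate[OF assms(1)] col_sym by metis

text \<open>  A point \<open>q\<close> that is collinear to all of \<open>H\<close> but not to all of \<open>U\<close> cuts out exactly \<open>H\<close> from \<open>U\<close>, since
  nothing lies strictly between \<open>H\<close> and \<open>U\<close>. A line always has a point collinear to \<open>q\<close>.\<close>

lemma line_meets_hyperplane:
  assumes U: "singular U" and H: "singular H" "H \<subseteq> U" "rk U = Suc (rk H)"
    and l: "l \<in> L" "l \<subseteq> U"
  shows "\<exists>t\<in>l. t \<in> H"
proof -
  obtain a where a: "a \<in> U" "a \<notin> H" using H by (metis n_not_Suc_n subsetI subset_antisym)
  then obtain q where q: "q \<in> P" "\<forall>s\<in>H. q \<sim> s" "\<not> q \<sim> a"
    using separate[OF H(1)] singular_points[OF U] by blast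
  obtain t where t: "t \<in> l" "q \<sim> t" using col_some[OF q(1) l(1)] by blast
  have "t \<in> H"
  proof (rule ccontr)
    assume "t \<notin> H"
    then have "span (insert t H) = U" using span_insert_eq[OF U H, of t] t l by blast
    then have "q \<sim> a"
      using col_span[of "insert t H" q a] a q t H singular_points[OF U] l by blast
    then show False using q by blast
  qed
  then show ?thesis using t by blast
qed

text \<open>  Any line of \<open>A\<close> through a point \<open>a\<close> outside \<open>H\<close> meets \<open>H\<close>, so \<open>a\<close> and \<open>A \<inter> H\<close> span \<open>A\<close>.\<close>

lemma rk_Int_hyperplane:
  assumes U: "singular U" and H: "singular H" "H \<subseteq> U" "rk U = Suc (rk H)"
    and A: "singular A" "A \<subseteq> U" "\<not> A \<subseteq> H"
  shows "rk A = Suc (rk (A \<inter> H))"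
proof -
  have T: "singular (A \<inter> H)" using A H singular_Int by blast
  obtain a where a: "a \<in> A" "a \<notin> H" using A by blast
  have o: "\<forall>s\<in>A \<inter> H. a \<sim> s" "a \<in> P"
    using a singular_orth[OF A(1)] singular_points[OF A(1)] by (auto simp: orth_def)
  have sub: "lin_subspace P L (span (insert a (A \<inter> H)))"
    using singular_insert[OF T o(2,1)] singular_subspace by blast
  have ins: "insert a (A \<inter> H) \<subseteq> span (insert a (A \<inter> H))" by (rule span_subset)
  have "span (insert a (A \<inter> H)) = A"
  proof
    show "span (insert a (A \<inter> H)) \<subseteq> A" using a A singular_subspace by (intro span_least) auto
    show "A \<subseteq> span (insert a (A \<inter> H))"
    proof
      fix c assume c: "c \<in> A"
      show "c \<in> span (insert a (A \<inter> H))"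
      proof (cases "c = a")
        case False
        have "a \<sim> c" using c a singular_orth[OF A(1)] by (auto simp: orth_def)
        then obtain l where l: "l \<in> L" "a \<in> l" "c \<in> l" using join False by blast
        have "l \<subseteq> A" using subspace_line[OF singular_subspace[OF A(1)] a(1) c _ l] False by blast
        then obtain t where t: "t \<in> l" "t \<in> H" using line_meets_hyperplane[OF U H l(1)] A by blast
        then have "a \<noteq> t" using a by blast
        have "l \<subseteq> span (insert a (A \<inter> H))"
          using subspace_line[OF sub _ _ \<open>a \<noteq> t\<close> l(1,2) t(1)] ins t \<open>l \<subseteq> A\<close> by blast
        then show ?thesis using l by blast
      qed (use ins in auto)
    qed
  qed
  then show ?thesis using rk_insert[OF T o(2,1)] a by simp
qed


section \<open>The Grassmann graph\<close>

abbreviation G :: "nat \<Rightarrow> 'a set set" where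
  "G k \<equiv> polar_grassmannian P L k"

abbreviation adj :: "nat \<Rightarrow> 'a set \<Rightarrow> 'a set \<Rightarrow> bool" where
  "adj k X Y \<equiv> adj11 P L k X Y"

lemma G_iff: "X \<in> G k \<longleftrightarrow> singular X \<and> rk X = Suc k"
  using has_pdim_iff_rk[of X "int k"] unfolding polar_grassmannian_def by auto

lemma G_singular: "X \<in> G k \<Longrightarrow> singular X" and G_rk: "X \<in> G k \<Longrightarrow> rk X = Suc k"
  by (simp_all add: G_iff)

lemma G_points: "\<lbrakk>X \<in> G k; x \<in> X\<rbrakk> \<Longrightarrow> x \<in> P"
  using singular_points[OF G_singular] by blast

lemma G_col: "\<lbrakk>X \<in> G k; x \<in> X; y \<in> X\<rbrakk> \<Longrightarrow> x \<sim> y"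
  using singular_orth[OF G_singular] unfolding orth_def by blast

lemma G_line: "\<lbrakk>X \<in> G k; x \<in> X; y \<in> X; x \<noteq> y; l \<in> L; x \<in> l; y \<in> l\<rbrakk> \<Longrightarrow> l \<subseteq> X"
  using subspace_line[OF singular_subspace[OF G_singular]] by blast

lemma G_subset_eq: "\<lbrakk>X \<in> G k; Y \<in> G k; X \<subseteq> Y\<rbrakk> \<Longrightarrow> X = Y"
  using rk_subset_eq[of Y X] by (simp add: G_iff)

lemma G_Int_singular: "\<lbrakk>X \<in> G k; Y \<in> G j\<rbrakk> \<Longrightarrow> singular (X \<inter> Y)"
  using singular_Int G_singular by blast

text \<open>  The intersection of \<open>Y\<close> with the perp of \<open>X\<close> contains \<open>X \<inter> Y\<close>. If \<open>X \<inter> Y\<close> is a hyperplane of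
  \<open>Y\<close>, that leaves only \<open>X \<inter> Y\<close> and \<open>Y\<close> itself.\<close>

lemma adj_iff:
  assumes X: "X \<in> G k" and Y: "Y \<in> G k"
  shows "adj k X Y \<longleftrightarrow> rk (X \<inter> Y) = k \<and> \<not> orth X Y"
proof -
  have "lin_subspace P L (perp P L X)" using subspace_perp[of X] by (simp add: perp_def)
  then have pY: "singular (perp P L X \<inter> Y)"
    using singular_sub[OF G_singular[OF Y]] subspace_Int singular_subspace[OF G_singular[OF Y]] by auto
  have XY: "X \<inter> Y \<subseteq> perp P L X \<inter> Y"
    using G_col[OF X] G_points[OF X] by (auto simp: perp_def)
  have full: "perp P L X \<inter> Y = Y \<longleftrightarrow> orth X Y"
  proof -
    have "perp P L X \<inter> Y = Y \<longleftrightarrow> (\<forall>y\<in>Y. \<forall>x\<in>X. y \<sim> x)"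
      using G_points[OF Y] by (auto simp: perp_def)
    also have "\<dots> \<longleftrightarrow> orth Y X" by (simp add: orth_def)
    finally show ?thesis using orth_sym by simp
  qed
  have eq: "adj k X Y \<longleftrightarrow> rk (perp P L X \<inter> Y) = k \<and> rk (X \<inter> Y) = k"
    unfolding adj11_def has_pdim_iff_rk[OF pY] has_pdim_iff_rk[OF G_Int_singular[OF X Y]] by auto
  show ?thesis
  proof
    assume "adj k X Y"
    then show "rk (X \<inter> Y) = k \<and> \<not> orth X Y" using eq full G_rk[OF Y] by (metis n_not_Suc_n)
  next
    assume *: "rk (X \<inter> Y) = k \<and> \<not> orth X Y"
    have "rk (perp P L X \<inter> Y) < Suc k"
      using rk_strict_mono[OF G_singular[OF Y] pY] full * G_rk[OF Y] by (simp add: psubset_eq)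
    moreover have "k \<le> rk (perp P L X \<inter> Y)"
      using rk_mono[OF pY G_Int_singular[OF X Y] XY] * by simp
    ultimately show "adj k X Y" using eq * by simp
  qed
qed

lemma adj_sym: "\<lbrakk>X \<in> G k; Y \<in> G k\<rbrakk> \<Longrightarrow> adj k X Y \<longleftrightarrow> adj k Y X"
  using adj_iff[of X k Y] adj_iff[of Y k X] orth_sym[of X Y] by (simp add: Int_commute)

lemma adj_neq: "\<lbrakk>X \<in> G k; adj k X Y\<rbrakk> \<Longrightarrow> X \<noteq> Y"
  using adj_iff[of X k X] G_rk[of X k] by auto

lemma Int_eq:
  assumes "X \<in> G k" "Y \<in> G k" "X \<noteq> Y" "singular S" "rk S = k" "S \<subseteq> X" "S \<subseteq> Y"
  shows "X \<inter> Y = S"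
proof -
  have "X \<inter> Y \<noteq> X" using G_subset_eq assms by blast
  then have "rk (X \<inter> Y) < Suc k"
    using rk_strict_mono[OF G_singular[OF assms(1)] G_Int_singular[OF assms(1,2)]] G_rk[OF assms(1)]
    by (simp add: psubset_eq)
  then show ?thesis
    using rk_subset_eq[OF G_Int_singular[OF assms(1,2)] assms(4)] assms by simp
qed

lemma G_insert:
  assumes "singular S" "rk S = k" "x \<in> P" "\<forall>s\<in>S. x \<sim> s" "x \<notin> S"
  shows "span (insert x S) \<in> G k"
  using singular_insert[of S x] rk_insert[of S x] assms by (simp add: G_iff)

lemma in_span_insert: "x \<in> span (insert x S)" and sub_span_insert: "S \<subseteq> span (insert x S)"
  using span_subset[of "insert x S"] by auto

lemma G_eq_span:
  assumes "X \<in> G k" "singular S" "rk S = k" "S \<subseteq> X" "x \<in> X" "x \<notin> S"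
  shows "span (insert x S) = X"
  using span_insert_eq[of X S x] assms by (simp add: G_iff)

text \<open>  This lemma and the next reduce adjacency and orthogonality of two spaces through a common \<open>S\<close> to
  collinearity of single points, as in the residue of \<open>S\<close>.\<close>

lemma star_adj:
  assumes "X \<in> G k" "Y \<in> G k" "singular S" "rk S = k" "S \<subseteq> X" "S \<subseteq> Y"
    and "x \<in> X" "y \<in> Y" "\<not> x \<sim> y"
  shows "adj k X Y"
proof -
  have no: "\<not> orth X Y" using assms(7-9) unfolding orth_def by blast
  then have "X \<noteq> Y" using singular_orth[OF G_singular[OF assms(1)]] by auto
  then show ?thesis using Int_eq[OF assms(1,2) _ assms(3-6)] adj_iff assms no by simp
qed

lemma star_orth:
  assumes "X \<in> G k" "Y \<in> G k" "singular S" "rk S = k" "S \<subseteq> X" "S \<subseteq> Y"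
    and "x \<in> X" "x \<notin> S" "y \<in> Y" "y \<notin> S" "x \<sim> y"
  shows "orth X Y"
proof -
  have "orth (insert x S) (insert y S)"
    using assms G_col[OF assms(1)] G_col[OF assms(2)] unfolding orth_def by blast
  then have "orth (span (insert x S)) (span (insert y S))"
    using assms G_points by (intro orth_span_span) auto
  then show ?thesis using G_eq_span assms by metis
qed

text \<open>  A point \<open>s\<close> of \<open>X \<inter> Y\<close> outside \<open>Z\<close> would span \<open>X\<close> together with \<open>X \<inter> Z\<close>, and \<open>Y\<close> together with
  \<open>Y \<inter> Z\<close>. These generators are pairwise collinear, so \<open>X\<close> and \<open>Y\<close> would be orthogonal.\<close>

lemma triangle:
  assumes "X \<in> G k" "Y \<in> G k" "Z \<in> G k"
    and "adj k X Y" "rk (X \<inter> Z) = k" "rk (Y \<inter> Z) = k"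
  shows "X \<inter> Y \<subseteq> Z"
proof (rule ccontr)
  assume "\<not> X \<inter> Y \<subseteq> Z"
  then obtain s where s: "s \<in> X" "s \<in> Y" "s \<notin> Z" by blast
  have X: "span (insert s (X \<inter> Z)) = X"
    using G_eq_span[OF assms(1) G_Int_singular[OF assms(1,3)] assms(5)] s by simp
  have Y: "span (insert s (Y \<inter> Z)) = Y"
    using G_eq_span[OF assms(2) G_Int_singular[OF assms(2,3)] assms(6)] s by simp
  have "orth (insert s (X \<inter> Z)) (insert s (Y \<inter> Z))"
    using s G_col[OF assms(1)] G_col[OF assms(2)] G_col[OF assms(3)] unfolding orth_def by blast
  moreover have "insert s (X \<inter> Z) \<subseteq> P" "insert s (Y \<inter> Z) \<subseteq> P"
    using s G_points[OF assms(1)] G_points[OF assms(2)] by auto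
  ultimately have "orth X Y" using orth_span_span[of "insert s (X \<inter> Z)" "insert s (Y \<inter> Z)"] X Y by simp
  then show False using adj_iff assms by blast
qed

lemma star_iff:
  assumes "X \<in> G k" "Y \<in> G k" "Z \<in> G k" "adj k X Y"
  shows "X \<inter> Y \<subseteq> Z \<longleftrightarrow> (Z = X \<or> rk (X \<inter> Z) = k) \<and> (Z = Y \<or> rk (Y \<inter> Z) = k)"
proof
  assume sub: "X \<inter> Y \<subseteq> Z"
  have S: "singular (X \<inter> Y)" "rk (X \<inter> Y) = k" using G_Int_singular adj_iff assms by auto
  show "(Z = X \<or> rk (X \<inter> Z) = k) \<and> (Z = Y \<or> rk (Y \<inter> Z) = k)"
    using Int_eq[OF assms(1,3) _ S _ sub] Int_eq[OF assms(2,3) _ S _ sub] S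
    by (metis Int_lower1 Int_lower2)
next
  assume "(Z = X \<or> rk (X \<inter> Z) = k) \<and> (Z = Y \<or> rk (Y \<inter> Z) = k)"
  then show "X \<inter> Y \<subseteq> Z" using triangle[OF assms(1-4)] by blast
qed

section \<open>Sizes of intersecting lines\<close>

text \<open>  The two lines lie in a singular plane; projecting \<open>h\<close> to \<open>l\<close> from a point \<open>c\<close> on neither is
  injective.\<close>

lemma coplanar_card:
  assumes l: "l \<in> L" "w \<in> l" "x \<in> l" "x \<noteq> w" and h: "h \<in> L" "w \<in> h" "u \<in> h" "u \<noteq> w"
    and "u \<notin> l" "u \<sim> x" and fin: "finite l"
  shows "finite h \<and> card h \<le> card l"
proof -
  have "u \<sim> y" if "y \<in> l" for y
    using col_all[of l x w u y] l h that on_line_col[of h u w] assms(10) by blast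
  moreover have "u \<in> P" using h line_point by blast
  ultimately have N: "singular (span (insert u l))" "rk (span (insert u l)) = Suc (rk l)"
    using singular_insert[of l u] rk_insert[of l u] singular_line[OF l(1)] \<open>u \<notin> l\<close> by auto
  let ?N = "span (insert u l)"
  note line_N = subspace_line[OF singular_subspace[OF N(1)]]
  have lN: "l \<subseteq> ?N" and uN: "u \<in> ?N" by (rule sub_span_insert, rule in_span_insert)
  have hN: "h \<subseteq> ?N" using line_N[of u w h] lN uN l h by blast
  have "u \<noteq> x" using l \<open>u \<notin> l\<close> by blast
  \<comment> \<open>The centre \<open>c\<close> of projection is a third point on the line through \<open>u\<close> and \<open>x\<close>.\<close>
  then obtain e where e: "e \<in> L" "u \<in> e" "x \<in> e" using join[OF assms(10)] by blast
  obtain c where c: "c \<in> e" "c \<noteq> u" "c \<noteq> x" using third_point[OF e(1)] by blast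
  have "c \<in> ?N" using line_N[of u x e] lN uN l e c \<open>u \<noteq> x\<close> by blast
  have "c \<notin> l" using line_unique[of e l c x] c e l \<open>u \<notin> l\<close> by blast
  have "x \<notin> h" using line_unique[of l h x w] l h \<open>u \<notin> l\<close> by blast
  then have "c \<notin> h" using line_unique[of e h c u] c e h by blast
  have "\<exists>t\<in>l. \<exists>g\<in>L. c \<in> g \<and> p \<in> g \<and> t \<in> g" if "p \<in> h" for p
  proof -
    have "p \<noteq> c" "p \<in> ?N" using that hN \<open>c \<notin> h\<close> by auto
    then have "c \<sim> p" using singular_orth[OF N(1)] \<open>c \<in> ?N\<close> unfolding orth_def by blast
    then obtain g where g: "g \<in> L" "c \<in> g" "p \<in> g" using join \<open>p \<noteq> c\<close> by blast
    then have "g \<subseteq> ?N" using line_N[of c p g] \<open>c \<in> ?N\<close> \<open>p \<in> ?N\<close> \<open>p \<noteq> c\<close> by blast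
    then show ?thesis
      using line_meets_hyperplane[OF N(1) singular_line[OF l(1)] lN N(2) g(1)] g by blast
  qed
  then obtain f where f: "\<And>p. p \<in> h \<Longrightarrow> f p \<in> l"
    and f_line: "\<And>p. p \<in> h \<Longrightarrow> \<exists>g\<in>L. c \<in> g \<and> p \<in> g \<and> f p \<in> g" by metis
  have "inj_on f h"
  proof (rule inj_onI, rule ccontr)
    fix p p' assume p: "p \<in> h" "p' \<in> h" "f p = f p'" "p \<noteq> p'"
    obtain g where g: "g \<in> L" "c \<in> g" "p \<in> g" "f p \<in> g" using f_line p by blast
    obtain g' where g': "g' \<in> L" "c \<in> g'" "p' \<in> g'" "f p \<in> g'" using f_line[OF p(2)] p by auto
    have "c \<noteq> f p" using f p \<open>c \<notin> l\<close> by auto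
    then have "g = g'" using line_unique g g' by blast
    then have "g = h" using line_unique[of g h p p'] g g' p h by blast
    then show False using g \<open>c \<notin> h\<close> by blast
  qed
  moreover have "f ` h \<subseteq> l" using f by (rule image_subsetI)
  ultimately show ?thesis using card_inj_on_le[of f h l] inj_on_finite[of f h l] fin by simp
qed

text \<open>  As \<open>n \<ge> 3\<close>, some line \<open>h\<close> through \<open>w\<close> is coplanar with both \<open>l\<close> and \<open>m\<close>: take a singular plane
  through \<open>l\<close> and in it a line \<open>e\<close> through \<open>x\<close> other than \<open>l\<close>; \<open>h\<close> joins \<open>w\<close> to the point of \<open>e\<close> that is
  collinear to \<open>y\<close>.\<close>

lemma intersecting_lines_card:
  assumes l: "l \<in> L" "w \<in> l" "x \<in> l" and m: "m \<in> L" "w \<in> m" "y \<in> m" and xy: "\<not> x \<sim> y"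
    and fin: "finite l"
  shows "finite m \<and> card m \<le> card l"
proof -
  have "x \<noteq> w" using xy on_line_col m by blast
  have "y \<noteq> w" using xy on_line_col l by blast
  obtain v where v: "v \<in> P" "\<forall>s\<in>l. v \<sim> s" "v \<notin> l"
    using extend[OF singular_line[OF l(1)]] rk_line[OF l(1)] rank_ge by auto
  then have "v \<noteq> x" using l by blast
  then obtain e where e: "e \<in> L" "v \<in> e" "x \<in> e" using join v l by blast
  obtain u where u: "u \<in> e" "y \<sim> u" using col_some[OF line_point[OF m(1,3)] e(1)] by blast
  have "u \<noteq> x" using u xy col_sym by blast
  have "u \<notin> l" using line_unique[of e l u x] u e l \<open>u \<noteq> x\<close> v by blast
  have "u \<sim> w" using col_all'[of e v x w u] e u v l \<open>v \<noteq> x\<close> on_line_col[OF l(1,3,2)] by blast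
  have "u \<noteq> w" using \<open>u \<notin> l\<close> l by blast
  then obtain h where h: "h \<in> L" "u \<in> h" "w \<in> h" using join \<open>u \<sim> w\<close> by blast
  have ux: "u \<sim> x" using on_line_col e u by blast
  have h_card: "finite h \<and> card h \<le> card l"
    using coplanar_card[OF l(1,2,3) \<open>x \<noteq> w\<close> h(1,3,2) \<open>u \<noteq> w\<close> \<open>u \<notin> l\<close> ux fin] .
  have "y \<notin> h"
  proof
    assume "y \<in> h"
    then have "y \<sim> x"
      using col_all'[of h u w x y] h ux on_line_col[OF l(1,2,3)] \<open>u \<noteq> w\<close> by blast
    then show False using xy col_sym by blast
  qed
  then have "finite m \<and> card m \<le> card h"
    using coplanar_card[of h w u m y] h m u \<open>u \<noteq> w\<close> \<open>y \<noteq> w\<close> h_card by blast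
  then show ?thesis using h_card by simp
qed


section \<open>Common neighbours\<close>

definition nbr :: "nat \<Rightarrow> 'a set \<Rightarrow> 'a set \<Rightarrow> 'a set \<Rightarrow> bool" where
  "nbr k X Z Y \<longleftrightarrow> Y \<in> G k \<and> adj k X Y \<and> adj k Z Y"

text \<open>  In the residue of \<open>X \<inter> Z\<close>, an orthogonal pair consists of two collinear points. The line \<open>l\<close>
  represents the line joining them and serves to compute in the polar space itself.\<close>

lemma orthogonal_pair_line:
  assumes X: "X \<in> G k" "Z \<in> G k" and "X \<noteq> Z" "orth X Z" "rk (X \<inter> Z) = k"
  obtains x z l where "x \<in> X" "x \<notin> Z" "z \<in> Z" "z \<notin> X" "l \<in> L" "x \<in> l" "z \<in> l" "x \<noteq> z"
    "l \<subseteq> {p \<in> P. \<forall>s\<in>X \<inter> Z. p \<sim> s}" "l \<inter> (X \<inter> Z) = {}"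
proof -
  obtain x where x: "x \<in> X" "x \<notin> Z" using G_subset_eq[OF X] assms(3) by blast
  obtain z where z: "z \<in> Z" "z \<notin> X" using G_subset_eq[OF X(2,1)] assms(3) by blast
  have "x \<noteq> z" using x z by blast
  have "x \<sim> z" using x z assms(4) unfolding orth_def by blast
  then obtain l where l: "l \<in> L" "x \<in> l" "z \<in> l" using join \<open>x \<noteq> z\<close> by blast
  have "x \<in> {p \<in> P. \<forall>s\<in>X \<inter> Z. p \<sim> s}" "z \<in> {p \<in> P. \<forall>s\<in>X \<inter> Z. p \<sim> s}"
    using x z G_points[OF X(1)] G_points[OF X(2)] G_col[OF X(1)] G_col[OF X(2)] by auto
  then have "l \<subseteq> {p \<in> P. \<forall>s\<in>X \<inter> Z. p \<sim> s}"
    using subspace_line[OF subspace_perp] \<open>x \<noteq> z\<close> l by blast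
  moreover have "l \<inter> (X \<inter> Z) = {}"
    using G_line[OF X(1) x(1) _ _ l(1,2)] l x z by blast
  ultimately show thesis using that x z l \<open>x \<noteq> z\<close> by blast
qed

text \<open>  The point \<open>y\<close> separates \<open>x\<close> from the span of \<open>w\<close> and \<open>X \<inter> Z\<close>; having \<open>w\<close> as a neighbour on \<open>l\<close>, it
  has no other.\<close>

lemma star_separate:
  assumes X: "X \<in> G k" "Z \<in> G k" and S: "rk (X \<inter> Z) = k"
    and x: "x \<in> X" and z: "z \<in> Z" "z \<notin> X"
    and l: "l \<in> L" "x \<in> l" "z \<in> l" "l \<subseteq> {p \<in> P. \<forall>s\<in>X \<inter> Z. p \<sim> s}" "l \<inter> (X \<inter> Z) = {}"
    and w: "w \<in> l" "w \<noteq> x" "w \<noteq> z"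
  shows "\<exists>y\<in>P. (\<forall>s\<in>X \<inter> Z. y \<sim> s) \<and> y \<sim> w \<and> \<not> y \<sim> x \<and> \<not> y \<sim> z"
proof -
  have W: "span (insert w (X \<inter> Z)) \<in> G k"
    using l w by (intro G_insert G_Int_singular[OF X] S) auto
  have "x \<notin> span (insert w (X \<inter> Z))"
  proof
    assume *: "x \<in> span (insert w (X \<inter> Z))"
    then have "l \<subseteq> span (insert w (X \<inter> Z))"
      using G_line[OF W * in_span_insert w(2)[symmetric] l(1,2) w(1)] by blast
    moreover have "span (insert x (X \<inter> Z)) = X" "span (insert x (X \<inter> Z)) = span (insert w (X \<inter> Z))"
      using G_eq_span[OF X(1) G_Int_singular[OF X] S _ x] G_eq_span[OF W G_Int_singular[OF X] S sub_span_insert *]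
        l by auto
    ultimately show False using l z by blast
  qed
  then obtain y where y: "y \<in> P" "\<forall>s\<in>span (insert w (X \<inter> Z)). y \<sim> s" "\<not> y \<sim> x"
    using separate[OF G_singular[OF W]] G_points[OF X(1) x] by blast
  have yw: "y \<sim> w" using y(2) in_span_insert by blast
  have "\<not> y \<sim> z" using col_all[OF l(1,3) w(1) w(3)[symmetric] _ yw l(2)] y by blast
  then show ?thesis using y yw sub_span_insert by blast
qed

lemma nbr_insert:
  assumes X: "X \<in> G k" "Z \<in> G k" and S: "rk (X \<inter> Z) = k"
    and x: "x \<in> X" "z \<in> Z" and y: "y \<in> P" "\<forall>s\<in>X \<inter> Z. y \<sim> s" "\<not> y \<sim> x" "\<not> y \<sim> z"
  shows "nbr k X Z (span (insert y (X \<inter> Z)))"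
proof -
  have "y \<notin> X \<inter> Z" using y x G_col[OF X(1)] by blast
  then have Y: "span (insert y (X \<inter> Z)) \<in> G k"
    using y by (intro G_insert G_Int_singular[OF X] S) auto
  then show ?thesis
    using star_adj[OF X(1) Y G_Int_singular[OF X] S _ sub_span_insert x(1) in_span_insert]
      star_adj[OF X(2) Y G_Int_singular[OF X] S _ sub_span_insert x(2) in_span_insert] y col_sym
    unfolding nbr_def by auto
qed

lemma orthogonal_pair_nbr:
  assumes "X \<in> G k" "Z \<in> G k" "X \<noteq> Z" "orth X Z" "rk (X \<inter> Z) = k"
  shows "\<exists>Y. nbr k X Z Y"
proof -
  obtain x z l where xzl: "x \<in> X" "x \<notin> Z" "z \<in> Z" "z \<notin> X" "l \<in> L" "x \<in> l" "z \<in> l" "x \<noteq> z"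
    "l \<subseteq> {p \<in> P. \<forall>s\<in>X \<inter> Z. p \<sim> s}" "l \<inter> (X \<inter> Z) = {}"
    by (rule orthogonal_pair_line[OF assms])
  obtain w where "w \<in> l" "w \<noteq> x" "w \<noteq> z" using third_point[OF xzl(5)] by blast
  then show ?thesis
    using star_separate[OF assms(1,2,5) xzl(1,3,4,5,6,7,9,10)] nbr_insert[OF assms(1,2,5) xzl(1,3)]
    by blast
qed

text \<open>  In the residue of \<open>S = X \<inter> Z\<close> the common neighbours are the points collinear to neither \<open>x\<close> nor
  \<open>z\<close>; these are the points that satisfy \<open>C\<close> below. Suppose they are pairwise collinear. Then they
  all have the same neighbour \<open>w\<close> on the line \<open>l\<close> joining \<open>x\<close> and \<open>z\<close>, and \<open>l\<close> has only three
  points. The line through \<open>w\<close> and the first common neighbour then has at most three points as well,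
  and only two of them can be common neighbours. So three common neighbours do not lie on one line
  through \<open>w\<close>, and two that lie on different lines through \<open>w\<close> lead to a point \<open>q\<close> that satisfies \<open>C\<close>
  and is not collinear to one of them.\<close>

lemma orthogonal_pair_adjacent_nbrs:
  assumes X: "X \<in> G k" "Z \<in> G k" and "X \<noteq> Z" "orth X Z" and S: "rk (X \<inter> Z) = k"
    and Y: "nbr k X Z Y1" "nbr k X Z Y2" "nbr k X Z Y3" "Y1 \<noteq> Y2" "Y1 \<noteq> Y3" "Y2 \<noteq> Y3"
  shows "\<exists>Y Y'. nbr k X Z Y \<and> nbr k X Z Y' \<and> adj k Y Y'"
proof (rule ccontr)
  assume neg: "\<not> ?thesis"
  obtain x z l where x: "x \<in> X" "x \<notin> Z" and z: "z \<in> Z" "z \<notin> X" and l: "l \<in> L" "x \<in> l" "z \<in> l"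
    "l \<subseteq> {p \<in> P. \<forall>s\<in>X \<inter> Z. p \<sim> s}" "l \<inter> (X \<inter> Z) = {}" and "x \<noteq> z"
    by (rule orthogonal_pair_line[OF assms(1-5)])
  define S where "S = X \<inter> Z"
  have S': "singular S" "rk S = k" using G_Int_singular[OF X] S by (simp_all add: S_def)
  have SX: "S \<subseteq> X" "S \<subseteq> Z" by (auto simp: S_def)
  have SP: "S \<subseteq> P" using singular_points[OF S'(1)] .
  define C where "C y \<longleftrightarrow> y \<in> P \<and> (\<forall>s\<in>S. y \<sim> s) \<and> \<not> y \<sim> x \<and> \<not> y \<sim> z" for y
  have CS: "y \<notin> S" if "C y" for y using that G_col[OF X(1) _ x(1)] by (auto simp: C_def S_def)
  have clique: "y \<sim> y'" if "C y" "C y'" for y y'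
  proof (rule ccontr)
    assume no: "\<not> y \<sim> y'"
    have n: "nbr k X Z (span (insert y S))" "nbr k X Z (span (insert y' S))"
      using nbr_insert[OF X S x(1) z(1)] that by (auto simp: C_def S_def)
    then have "adj k (span (insert y S)) (span (insert y' S))"
      using star_adj[OF _ _ S' sub_span_insert sub_span_insert in_span_insert in_span_insert no]
      by (simp add: nbr_def)
    with n neg show False by blast
  qed
  have nbr_point: "\<exists>y\<in>Y. C y \<and> Y = span (insert y S)" if "nbr k X Z Y" for Y
  proof -
    have Y: "Y \<in> G k" "adj k X Y" "adj k Z Y" using that by (auto simp: nbr_def)
    have "Y \<inter> X \<subseteq> Z"
      using triangle[OF Y(1) X(1,2)] adj_sym Y X S adj_iff[OF X(2) Y(1)] by (simp add: Int_commute)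
    moreover have "rk (Y \<inter> X) = k" using adj_iff[OF X(1) Y(1)] Y(2) by (simp add: Int_commute)
    ultimately have "Y \<inter> X = S"
      using rk_subset_eq[OF S'(1) G_Int_singular[OF Y(1) X(1)]] S'(2) by (simp add: S_def)
    then have SY: "S \<subseteq> Y" by blast
    obtain y where y: "y \<in> Y" "y \<notin> S"
      using G_rk[OF Y(1)] S'(2) SY by (metis n_not_Suc_n subsetI subset_antisym)
    have xS: "x \<notin> S" "z \<notin> S" using x z by (auto simp: S_def)
    have "\<not> x \<sim> y"
      using star_orth[OF X(1) Y(1) S' SX(1) SY x(1) xS(1) y] Y(2) adj_iff[OF X(1) Y(1)] by blast
    moreover have "\<not> z \<sim> y"
      using star_orth[OF X(2) Y(1) S' SX(2) SY z(1) xS(2) y] Y(3) adj_iff[OF X(2) Y(1)] by blast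
    moreover have "\<forall>s\<in>S. y \<sim> s" using G_col[OF Y(1) y(1)] SY by blast
    ultimately have "C y" using G_points[OF Y(1) y(1)] col_sym unfolding C_def by metis
    then show ?thesis using G_eq_span[OF Y(1) S' SY y] y by blast
  qed
  have lS: "\<forall>s\<in>S. p \<sim> s" and lP: "p \<in> P" and lnS: "p \<notin> S" if "p \<in> l" for p
    using l that by (auto simp: S_def)
  \<comment> \<open>On a line through a point of \<open>l\<close> other than \<open>x\<close> and \<open>z\<close>, one point satisfying \<open>C\<close> suffices for all points off \<open>l\<close> to do so.\<close>
  have C_line: "C v" if "g \<in> L" "p \<in> g" "y \<in> g" "p \<in> l" "p \<noteq> x" "p \<noteq> z" "C y" "y \<sim> p" "v \<in> g" "v \<noteq> p"
    for g p y v
  proof -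
    have py: "p \<noteq> y" using that l on_line_col unfolding C_def by blast
    have "\<forall>s\<in>S. v \<sim> s"
      using col_all'[OF that(1-3) py _ _ that(9)] lS[OF that(4)] that(7) unfolding C_def by blast
    moreover have "\<not> v \<sim> q" if "q = x \<or> q = z" for q
    proof
      assume "v \<sim> q"
      then have "y \<sim> q"
        using col_all'[of g v p q y] \<open>v \<noteq> p\<close> \<open>g \<in> L\<close> \<open>p \<in> g\<close> \<open>y \<in> g\<close> \<open>v \<in> g\<close> on_line_col[OF l(1) \<open>p \<in> l\<close>] l that
        by blast
      then show False using \<open>C y\<close> that unfolding C_def by blast
    qed
    ultimately show ?thesis using line_point[OF that(1) that(9)] unfolding C_def by blast
  qed
  obtain y1 where y1: "y1 \<in> Y1" "C y1" "Y1 = span (insert y1 S)" using nbr_point[OF Y(1)] by blast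
  obtain w where w: "w \<in> l" "y1 \<sim> w" using col_some[OF _ l(1)] y1 unfolding C_def by blast
  have wxz: "w \<noteq> x" "w \<noteq> z" using w y1 unfolding C_def by auto
  have one: "p = p'" if "C y" "p \<in> l" "p' \<in> l" "y \<sim> p" "y \<sim> p'" for y p p'
    using col_all[OF l(1) that(2,3) _ that(4,5) l(2)] that(1) unfolding C_def by blast
  have Cw: "y \<sim> w" if "C y" for y
  proof (rule ccontr)
    assume yw: "\<not> y \<sim> w"
    have "y \<in> P" using that by (simp add: C_def)
    then obtain p where p: "p \<in> l" "y \<sim> p" using col_some l(1) by blast
    have pxz: "p \<noteq> x" "p \<noteq> z" "p \<noteq> w" using p that yw unfolding C_def by auto
    have "p \<noteq> y" using yw on_line_col[OF l(1) p(1) w(1)] by auto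
    then obtain g where g: "g \<in> L" "y \<in> g" "p \<in> g" using join p by blast
    \<comment> \<open>Collinear to the two points \<open>y\<close> and \<open>v\<close> of \<open>g\<close>, \<open>y1\<close> would get \<open>p\<close> as a second neighbour on \<open>l\<close>.\<close>
    obtain v where v: "v \<in> g" "v \<noteq> y" "v \<noteq> p" using third_point[OF g(1)] by blast
    have "C v" using C_line[OF g(1,3,2) p(1) pxz(1,2) that p(2) v(1,3)] .
    then have "y1 \<sim> p"
      using col_all[OF g(1) v(1) g(2) v(2) clique clique g(3)] y1(2) that by blast
    then show False using one[OF y1(2) p(1) w(1)] w pxz by blast
  qed
  \<comment> \<open>A fourth point of \<open>l\<close> would be the neighbour of some point satisfying \<open>C\<close>.\<close>
  have "l \<subseteq> {x, z, w}"
  proof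
    fix p assume p: "p \<in> l"
    show "p \<in> {x, z, w}"
    proof (rule ccontr)
      assume "p \<notin> {x, z, w}"
      then have "p \<noteq> x" "p \<noteq> z" "p \<noteq> w" by auto
      then obtain y where "y \<in> P" "\<forall>s\<in>S. y \<sim> s" "y \<sim> p" "\<not> y \<sim> x" "\<not> y \<sim> z"
        using star_separate[OF X S x(1) z l p] unfolding S_def by blast
      then show False using one[of y p w] Cw p w \<open>p \<noteq> w\<close> unfolding C_def by blast
    qed
  qed
  then have l3: "finite l" "card l \<le> 3"
    using finite_subset[of l "{x, z, w}"] card_mono[of "{x, z, w}" l] card_insert_le_m1[of 3]
    by (auto simp: card_insert_if split: if_splits)
  have "w \<noteq> y1" using y1 on_line_col[OF l(1) w(1) l(2)] unfolding C_def by auto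
  then obtain m where m: "m \<in> L" "w \<in> m" "y1 \<in> m" using join w col_sym by metis
  have m3: "finite m" "card m \<le> 3"
    using intersecting_lines_card[OF l(1) w(1) l(2) m] y1(2) l3 col_sym unfolding C_def by auto
  \<comment> \<open>Modulo \<open>S\<close>, the space \<open>N\<close> is the line joining \<open>w\<close> and \<open>y1\<close>.\<close>
  define W where "W = span (insert w S)"
  have W: "W \<in> G k" unfolding W_def using lS lP lnS w by (intro G_insert S') auto
  have SW: "S \<subseteq> W" "w \<in> W" unfolding W_def by (rule sub_span_insert, rule in_span_insert)
  have perpW: "\<forall>s\<in>W. q \<sim> s" if "\<forall>s\<in>S. q \<sim> s" "q \<sim> w" for q
    using col_span[of "insert w S" q] that lP[OF w(1)] SP unfolding W_def by blast
  have CW: "\<forall>s\<in>W. y \<sim> s" if "C y" for y using perpW[OF _ Cw] that unfolding C_def by blast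
  have xW: "\<forall>s\<in>W. x \<sim> s" using perpW lS l(2) on_line_col[OF l(1,2) w(1)] by blast
  have CnW: "y \<notin> W" if "C y" for y using xW that col_sym unfolding C_def by blast
  define N where "N = span (insert y1 W)"
  have N: "N \<in> G (Suc k)"
    using CW[OF y1(2)] CnW[OF y1(2)] y1(2) G_singular[OF W] G_rk[OF W]
    unfolding N_def by (intro G_insert) (auto simp: C_def)
  have WN: "W \<subseteq> N" "y1 \<in> N" unfolding N_def by (rule sub_span_insert, rule in_span_insert)
  have mN: "m \<subseteq> N" using G_line[OF N _ WN(2) _ m] WN SW \<open>w \<noteq> y1\<close> by blast
  have meet: "\<exists>t\<in>m. t \<in> Y \<and> t \<noteq> w \<and> t \<noteq> y1 \<and> t \<notin> S"
    if Y: "nbr k X Z Y" "Y \<subseteq> N" "Y \<noteq> Y1" for Y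
  proof -
    have Yk: "Y \<in> G k" using Y by (simp add: nbr_def)
    obtain y where y: "y \<in> Y" "C y" "Y = span (insert y S)" using nbr_point[OF Y(1)] by blast
    have SY: "S \<subseteq> Y" unfolding y(3) by (rule sub_span_insert)
    obtain t where t: "t \<in> m" "t \<in> Y"
      using line_meets_hyperplane[OF G_singular[OF N] G_singular[OF Yk] Y(2) _ m(1) mN]
        G_rk[OF N] G_rk[OF Yk] by auto
    have "t \<noteq> w"
    proof
      assume "t = w"
      then have "Y = W" using G_eq_span[OF Yk S' SY t(2)] lnS[OF w(1)] unfolding W_def by auto
      then show False using CnW y by blast
    qed
    moreover have "t \<noteq> y1" using G_eq_span[OF Yk S' SY t(2)] CS[OF y1(2)] y1(3) Y(3) by auto
    moreover have "t \<notin> S"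
    proof
      assume "t \<in> S"
      then have "x \<sim> t" using lS[OF l(2)] by blast
      then have "x \<sim> y1"
        using col_all[OF m(1) t(1) m(2) \<open>t \<noteq> w\<close> _ on_line_col[OF l(1,2) w(1)] m(3)] by blast
      then show False using y1(2) col_sym unfolding C_def by blast
    qed
    ultimately show ?thesis using t by blast
  qed
  \<comment> \<open>If both \<open>Y2\<close> and \<open>Y3\<close> lay in \<open>N\<close>, the line \<open>m\<close> would have four points.\<close>
  have "\<exists>y. C y \<and> y \<notin> N"
  proof (rule ccontr)
    assume "\<not> ?thesis"
    then have inN: "y \<in> N" if "C y" for y using that by blast
    have YN: "Y \<subseteq> N" if Y: "nbr k X Z Y" for Y
    proof -
      obtain y where y: "C y" "Y = span (insert y S)" using nbr_point[OF Y] by blast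
      show ?thesis unfolding y(2)
        using inN[OF y(1)] SW WN singular_subspace[OF G_singular[OF N]] by (intro span_least) auto
    qed
    obtain t2 where t2: "t2 \<in> m" "t2 \<in> Y2" "t2 \<noteq> w" "t2 \<noteq> y1" "t2 \<notin> S"
      using meet[OF Y(2) YN[OF Y(2)]] Y(4) by blast
    obtain t3 where t3: "t3 \<in> m" "t3 \<in> Y3" "t3 \<noteq> w" "t3 \<noteq> y1" "t3 \<notin> S"
      using meet[OF Y(3) YN[OF Y(3)]] Y(5) by blast
    have "t2 \<noteq> t3"
    proof
      assume "t2 = t3"
      have "S \<subseteq> Y2" "S \<subseteq> Y3"
        using nbr_point[OF Y(2)] nbr_point[OF Y(3)] sub_span_insert by blast+
      then have "span (insert t2 S) = Y2" "span (insert t2 S) = Y3"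
        using G_eq_span[OF _ S'] t2 t3 \<open>t2 = t3\<close> Y(2,3) unfolding nbr_def by auto
      then show False using Y(6) by simp
    qed
    then have "card {w, y1, t2, t3} = 4" using t2 t3 \<open>w \<noteq> y1\<close> by simp
    moreover have "{w, y1, t2, t3} \<subseteq> m" using m t2 t3 by blast
    ultimately show False using m3 card_mono[of m "{w, y1, t2, t3}"] by simp
  qed
  then obtain y where y: "C y" "y \<notin> N" by blast
  have "y \<noteq> y1" using y WN by blast
  obtain e where e: "e \<in> L" "y \<in> e" "y1 \<in> e" using join[OF clique[OF y(1) y1(2)] \<open>y \<noteq> y1\<close>] by blast
  \<comment> \<open>A point \<open>q\<close> in the perp of \<open>W\<close>, collinear to \<open>y\<close> and to a third point \<open>v\<close> of the line joining \<open>x\<close> and \<open>t\<close>, but not to \<open>t\<close>, is collinear neither to \<open>y1\<close> nor to \<open>x\<close>.\<close>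
  obtain t where t: "t \<in> e" "x \<sim> t" using col_some[OF lP[OF l(2)] e(1)] by blast
  have "t \<noteq> y" "t \<noteq> y1" using t y(1) y1(2) col_sym unfolding C_def by metis+
  define V where "V = span (insert y W)"
  have ynW: "y \<notin> W" using y WN by blast
  have V: "V \<in> G (Suc k)"
    using CW[OF y(1)] ynW y(1) G_singular[OF W] G_rk[OF W]
    unfolding V_def by (intro G_insert) (auto simp: C_def)
  have WV: "W \<subseteq> V" "y \<in> V" unfolding V_def by (rule sub_span_insert, rule in_span_insert)
  have "t \<notin> V"
  proof
    assume "t \<in> V"
    then have "y1 \<in> V" using G_line[OF V _ WV(2) \<open>t \<noteq> y\<close> e(1) t(1) e(2)] e(3) by blast
    then have "span (insert y1 W) = V"
      using G_eq_span[OF V G_singular[OF W] G_rk[OF W] WV(1)] CnW[OF y1(2)] by blast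
    then show False using y WV unfolding N_def by blast
  qed
  then obtain q0 where q0: "q0 \<in> P" "\<forall>s\<in>V. q0 \<sim> s" "\<not> q0 \<sim> t"
    using separate[OF G_singular[OF V]] line_point[OF e(1) t(1)] by blast
  have "x \<noteq> t" using y(1) on_line_col[OF e(1) e(2) t(1)] unfolding C_def by auto
  then obtain h where h: "h \<in> L" "x \<in> h" "t \<in> h" using join t by blast
  obtain v where v: "v \<in> h" "v \<noteq> x" "v \<noteq> t" using third_point[OF h(1)] by blast
  have yt: "y \<sim> t" and y1t: "y1 \<sim> t" using on_line_col e t by auto
  have ty: "t \<sim> y" using yt col_sym by blast
  have vt: "v \<sim> t" using on_line_col h v by blast
  \<comment> \<open>Since \<open>v\<close> and \<open>y\<close> are not collinear, the projection of \<open>v\<close> to the line joining \<open>q0\<close> and \<open>y\<close> is not \<open>y\<close>.\<close>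
  have "\<not> v \<sim> y"
  proof
    assume "v \<sim> y"
    then have "v \<sim> y1" using col_all[OF e(1,2) t(1) \<open>t \<noteq> y\<close>[symmetric] _ vt e(3)] by blast
    then have "y1 \<sim> v" using col_sym by blast
    then have "y1 \<sim> x" using col_all[OF h(1) v(1) h(3) v(3) _ y1t h(2)] by blast
    then show False using y1(2) unfolding C_def by blast
  qed
  have "q0 \<noteq> y" using q0 yt by auto
  have "q0 \<sim> y" using q0 WV by blast
  then obtain i where i: "i \<in> L" "q0 \<in> i" "y \<in> i" using join \<open>q0 \<noteq> y\<close> by blast
  obtain q where q: "q \<in> i" "v \<sim> q" using col_some[OF line_point[OF h(1) v(1)] i(1)] by blast
  have "q \<noteq> y" using q \<open>\<not> v \<sim> y\<close> by blast
  have qy: "q \<sim> y" using on_line_col i q by blast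
  have qv: "q \<sim> v" using q col_sym by blast
  have qt: "\<not> q \<sim> t"
  proof
    assume "q \<sim> t"
    then have "q0 \<sim> t" using col_all'[OF i(1) q(1) i(3) \<open>q \<noteq> y\<close> _ yt i(2)] by blast
    then show False using q0 by blast
  qed
  have qW: "q \<sim> s" if "s \<in> W" for s
    using col_all'[OF i(1,2,3) \<open>q0 \<noteq> y\<close> _ _ q(1)] q0 WV CW[OF y(1)] that by blast
  have "\<not> q \<sim> y1" using col_all[OF e(1,2,3) \<open>y \<noteq> y1\<close> qy _ t(1)] qt by blast
  moreover have "\<not> q \<sim> x" using col_all[OF h(1) v(1) h(2) v(2) qv _ h(3)] qt by blast
  moreover have "\<not> q \<sim> z"
    using col_all[OF l(1) w(1) l(3) wxz(2) qW[OF SW(2)] _ l(2)] \<open>\<not> q \<sim> x\<close> by blast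
  ultimately show False
    using clique[of q y1] y1(2) line_point[OF i(1) q(1)] qW SW unfolding C_def by blast
qed


text \<open>  Modulo \<open>T\<close>, the lines \<open>X\<close> and \<open>Z\<close> have a transversal through the collinear points \<open>c\<close> and \<open>d\<close>. It
  meets \<open>X\<close> in the span of \<open>c\<close> and \<open>T\<close>, which is a hyperplane of both.\<close>

lemma cross_nbr:
  assumes XZ: "X \<in> G k" "Z \<in> G k" and T: "singular T" "Suc (rk T) = k" "T \<subseteq> X" "T \<subseteq> Z"
    and c: "c \<in> X" "d \<in> Z" "c \<sim> d" and no: "z \<in> Z" "\<not> c \<sim> z" "x \<in> X" "\<not> d \<sim> x"
  shows "span (insert d (insert c T)) \<in> G k" "adj k X (span (insert d (insert c T)))"
proof -
  let ?K = "span (insert c T)"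
  have P: "c \<in> P" "d \<in> P" "insert c T \<subseteq> P"
    using G_points[OF XZ(1)] G_points[OF XZ(2)] c T by auto
  have "c \<notin> T" using no G_col[OF XZ(2) _ no(1)] T by blast
  moreover have "\<forall>s\<in>T. c \<sim> s" using G_col[OF XZ(1) c(1)] T by blast
  ultimately have K: "singular ?K" "rk ?K = k"
    using singular_insert[OF T(1)] rk_insert[OF T(1)] T P by auto
  have KX: "?K \<subseteq> X" using c T singular_subspace[OF G_singular[OF XZ(1)]] by (intro span_least) auto
  have "d \<notin> X" using no G_col[OF XZ(1) _ no(3)] by blast
  moreover have "\<forall>s\<in>insert c T. d \<sim> s" using c(3) col_sym G_col[OF XZ(2) c(2)] T by blast
  then have "\<forall>s\<in>?K. d \<sim> s" using col_span P by blast
  ultimately have "span (insert d ?K) \<in> G k" using KX P by (intro G_insert K) auto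
  moreover have eq: "span (insert d ?K) = span (insert d (insert c T))"
    using span_span_insert P by blast
  ultimately show N: "span (insert d (insert c T)) \<in> G k" by simp
  have "?K \<subseteq> span (insert d (insert c T))" by (rule span_mono) blast
  then show "adj k X (span (insert d (insert c T)))"
    using star_adj[OF XZ(1) N K KX _ no(3) in_span_insert] no(4) col_sym by blast
qed

text \<open>  \<open>X\<close> and \<open>Z\<close> meet the given common neighbour \<open>Y\<close> in distinct hyperplanes \<open>A\<close> and \<open>B\<close> of \<open>Y\<close>. Modulo
  \<open>T = A \<inter> B\<close>, they are lines and \<open>Y\<close> is a transversal, joining \<open>a\<close> on \<open>X\<close> to \<open>b\<close> on \<open>Z\<close>. Every
  point of the line \<open>l\<close> in \<open>X\<close> is collinear to a point of the line \<open>m\<close> in \<open>Z\<close>, which gives a transversal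
  for each point of \<open>l\<close>. Two points of \<open>l\<close> give different ones, since together with \<open>T\<close> they span \<open>X\<close>.\<close>

lemma transversal_pair_three_nbrs:
  assumes X: "X \<in> G k" "Z \<in> G k" and neq: "X \<noteq> Z" and rk: "rk (X \<inter> Z) \<noteq> k"
    and "nbr k X Z Y"
  shows "\<exists>Y1 Y2 Y3. nbr k X Z Y1 \<and> nbr k X Z Y2 \<and> nbr k X Z Y3 \<and> Y1 \<noteq> Y2 \<and> Y1 \<noteq> Y3 \<and> Y2 \<noteq> Y3"
proof -
  have Y: "Y \<in> G k" and aXY: "adj k X Y" and aZY: "adj k Z Y"
    using assms(5) by (auto simp: nbr_def)
  define A where "A = X \<inter> Y"
  define B where "B = Z \<inter> Y"
  have A: "singular A" "rk A = k" "A \<subseteq> X" "A \<subseteq> Y" and no1: "\<not> orth X Y"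
    using G_Int_singular[OF X(1) Y] adj_iff[OF X(1) Y] aXY by (auto simp: A_def)
  have B: "singular B" "rk B = k" "B \<subseteq> Z" "B \<subseteq> Y" and no2: "\<not> orth Z Y"
    using G_Int_singular[OF X(2) Y] adj_iff[OF X(2) Y] aZY by (auto simp: B_def)
  have "\<not> A \<subseteq> B" using Int_eq[OF X neq A(1,2,3)] A(2) B(3) rk by auto
  moreover have "\<not> B \<subseteq> A" using Int_eq[OF X neq B(1,2) _ B(3)] B(2) A(3) rk by auto
  ultimately obtain a b where a: "a \<in> A" "a \<notin> B" and b: "b \<in> B" "b \<notin> A" by blast
  have Yb: "span (insert b A) = Y" using G_eq_span[OF Y A(1,2,4)] b B by blast
  have Ya: "span (insert a B) = Y" using G_eq_span[OF Y B(1,2,4)] a A by blast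
  define T where "T = A \<inter> B"
  have T: "singular T" "Suc (rk T) = k"
    using singular_Int[OF A(1) B(1)] \<open>\<not> A \<subseteq> B\<close> A B G_rk[OF Y]
      rk_Int_hyperplane[OF G_singular[OF Y] B(1,4) _ A(1,4)] by (auto simp: T_def)
  have TXZ: "T \<subseteq> X" "T \<subseteq> Z" "T \<subseteq> A" using A B by (auto simp: T_def)
  have ab: "a \<in> X" "a \<in> Y" "b \<in> Z" "b \<in> Y" using a b A B by auto
  have AP: "A \<subseteq> P" "B \<subseteq> P" using singular_points A B by auto
  obtain x0 where x0: "x0 \<in> X" "x0 \<notin> A"
    using G_rk[OF X(1)] A(2,3) by (metis n_not_Suc_n subsetI subset_antisym)
  obtain z where z: "z \<in> Z" "z \<notin> B"
    using G_rk[OF X(2)] B(2,3) by (metis n_not_Suc_n subsetI subset_antisym)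
  have bX: "\<not> b \<sim> p" if "p \<in> X" "p \<notin> A" for p
    using star_orth[OF X(1) Y A(1,2,3,4) that ab(4) b(2)] no1 col_sym by blast
  have aZ: "\<not> a \<sim> p" if "p \<in> Z" "p \<notin> B" for p
    using star_orth[OF X(2) Y B(1,2,3,4) that ab(2) a(2)] no2 col_sym by blast
  have "a \<noteq> x0" using a x0 by blast
  then obtain l where l: "l \<in> L" "a \<in> l" "x0 \<in> l" using join G_col[OF X(1) ab(1) x0(1)] by blast
  have lX: "l \<subseteq> X" using G_line[OF X(1) ab(1) x0(1) \<open>a \<noteq> x0\<close> l] .
  have lA: "p \<notin> A" if "p \<in> l" "p \<noteq> a" for p
    using subspace_line[OF singular_subspace[OF A(1)] _ a(1) that(2) l(1) that(1) l(2)] x0 l by blast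
  obtain x where x: "x \<in> l" "z \<sim> x" using col_some[OF G_points[OF X(2) z(1)] l(1)] by blast
  have xa: "x \<noteq> a" using x aZ[OF z] col_sym by blast
  have "b \<noteq> z" using b z by blast
  then obtain m where m: "m \<in> L" "b \<in> m" "z \<in> m" using join G_col[OF X(2) ab(3) z(1)] by blast
  have mZ: "m \<subseteq> Z" using G_line[OF X(2) ab(3) z(1) \<open>b \<noteq> z\<close> m] .
  obtain c where c: "c \<in> l" "c \<noteq> a" "c \<noteq> x" using third_point[OF l(1)] by blast
  obtain d where d: "d \<in> m" "c \<sim> d" using col_some[OF line_point[OF l(1) c(1)] m(1)] by blast
  have cb: "\<not> c \<sim> b" and xb: "\<not> x \<sim> b" using bX lX lA c x xa col_sym by blast+
  have "d \<noteq> b" using d cb by blast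
  have da: "\<not> d \<sim> a"
  proof
    assume "d \<sim> a"
    then have "a \<sim> d" using col_sym by blast
    then have "a \<sim> z"
      using col_all[OF m(1) d(1) m(2) \<open>d \<noteq> b\<close> _ _ m(3)] G_col[OF Y ab(2,4)] by blast
    then show False using aZ[OF z] by blast
  qed
  \<comment> \<open>The transversals; the three used join \<open>a\<close> to \<open>b\<close>, \<open>x\<close> to \<open>z\<close> and \<open>c\<close> to \<open>d\<close>.\<close>
  let ?N = "\<lambda>c d. span (insert d (insert c T))"
  have N: "nbr k X Z (?N p q)" if "p \<in> X" "q \<in> Z" "p \<sim> q" "z' \<in> Z" "\<not> p \<sim> z'" "x' \<in> X" "\<not> q \<sim> x'"
    for p q x' z'
  proof -
    have "q \<sim> p" using that col_sym by blast
    then show ?thesis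
      using cross_nbr[OF X T TXZ(1,2) that] insert_commute[of p q T]
        cross_nbr[OF X(2,1) T TXZ(2,1) that(2,1) _ that(6,7,4,5)]
      unfolding nbr_def by simp
  qed
  have Nin: "p \<in> ?N p q" for p q using span_subset[of "insert q (insert p T)"] by blast
  have TN: "T \<subseteq> ?N p q" for p q using span_subset[of "insert q (insert p T)"] by blast
  have sep: "?N p q \<noteq> ?N p' q'"
    if "nbr k X Z (?N p q)" "p \<in> l" "p' \<in> l" "p \<noteq> p'" for p q p' q'
  proof
    assume eq: "?N p q = ?N p' q'"
    let ?M = "?N p q"
    have M: "?M \<in> G k" "adj k X ?M" using that(1) by (auto simp: nbr_def)
    have "l \<subseteq> ?M" using G_line[OF M(1) Nin _ that(4) l(1) that(2,3)] Nin[of p' q'] eq by auto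
    moreover have "span (insert a T) = A"
      using span_insert_eq[OF A(1) T(1) TXZ(3) _ a(1)] a A(2) T(2) by (simp add: T_def)
    ultimately have "A \<subseteq> ?M"
      using span_least[OF _ singular_subspace[OF G_singular[OF M(1)]], of "insert a T"]
        TN l by blast
    then have "span (insert x0 A) \<subseteq> ?M"
      using span_least[OF _ singular_subspace[OF G_singular[OF M(1)]], of "insert x0 A"]
        \<open>l \<subseteq> ?M\<close> l by blast
    then have "X \<subseteq> ?M" using G_eq_span[OF X(1) A(1,2,3) x0] by simp
    then show False using G_subset_eq[OF X(1) M(1)] adj_neq[OF X(1) M(2)] by blast
  qed
  have n1: "nbr k X Z (?N a b)"
    using N[OF ab(1,3) G_col[OF Y ab(2,4)] z(1) aZ[OF z] x0(1) bX[OF x0]] .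
  have n2: "nbr k X Z (?N x z)"
    using N[of x z b a] lX x z ab xb aZ[OF z] col_sym[of x z] col_sym[of z a] by auto
  have n3: "nbr k X Z (?N c d)"
    using N[of c d b a] lX mZ c d ab cb da by auto
  have "?N a b \<noteq> ?N x z" using sep[OF n1 l(2) x(1) xa[symmetric]] .
  moreover have "?N a b \<noteq> ?N c d" using sep[OF n1 l(2) c(1) c(2)[symmetric]] .
  moreover have "?N x z \<noteq> ?N c d" using sep[OF n2 x(1) c(1) c(3)[symmetric]] .
  ultimately show ?thesis using n1 n2 n3 by blast
qed

text \<open>  Adjacent common neighbours form triangles with \<open>X\<close> and with \<open>Z\<close>, so both \<open>X\<close> and \<open>Z\<close> would contain
  the intersection of these neighbours.\<close>

lemma transversal_pair_no_adjacent_nbrs: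
  assumes X: "X \<in> G k" "Z \<in> G k" and neq: "X \<noteq> Z" and rk: "rk (X \<inter> Z) \<noteq> k"
    and Y: "nbr k X Z Y" "nbr k X Z Y'"
  shows "\<not> adj k Y Y'"
proof
  assume a: "adj k Y Y'"
  have YG: "Y \<in> G k" "Y' \<in> G k" using Y by (auto simp: nbr_def)
  have rks: "rk (Y \<inter> X) = k" "rk (Y' \<inter> X) = k" "rk (Y \<inter> Z) = k" "rk (Y' \<inter> Z) = k"
    using Y adj_iff X YG by (auto simp: nbr_def Int_commute)
  have "Y \<inter> Y' \<subseteq> X" "Y \<inter> Y' \<subseteq> Z"
    using triangle[OF YG X(1) a rks(1,2)] triangle[OF YG X(2) a rks(3,4)] by auto
  moreover have "rk (Y \<inter> Y') = k" using a adj_iff YG by blast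
  ultimately show False
    using Int_eq[OF X neq G_Int_singular[OF YG]] rk by auto
qed

text \<open>  The right-hand side mentions adjacency only; hence every automorphism of the graph preserves the
  relation on the left.\<close>

lemma rk_Int_iff:
  assumes X: "X \<in> G k" "Z \<in> G k"
  defines "N \<equiv> {Y. nbr k X Z Y}"
  shows "rk (X \<inter> Z) = k \<longleftrightarrow> adj k X Z \<or> X \<noteq> Z \<and> N \<noteq> {} \<and>
    ((\<exists>Y1\<in>N. \<exists>Y2\<in>N. \<exists>Y3\<in>N. Y1 \<noteq> Y2 \<and> Y1 \<noteq> Y3 \<and> Y2 \<noteq> Y3) \<longrightarrow> (\<exists>Y\<in>N. \<exists>Y'\<in>N. adj k Y Y'))"
    (is "_ \<longleftrightarrow> _ \<or> ?R")
proof
  assume rk: "rk (X \<inter> Z) = k"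
  show "adj k X Z \<or> ?R"
  proof (cases "orth X Z")
    case True
    have neq: "X \<noteq> Z" using rk G_rk[OF X(1)] by auto
    show ?thesis
      using orthogonal_pair_nbr[OF X neq True rk] orthogonal_pair_adjacent_nbrs[OF X neq True rk] neq
      unfolding N_def by blast
  next
    case False
    then show ?thesis using rk adj_iff[OF X] by blast
  qed
next
  assume *: "adj k X Z \<or> ?R"
  show "rk (X \<inter> Z) = k"
  proof (rule ccontr)
    assume rk: "rk (X \<inter> Z) \<noteq> k"
    then have R: ?R using * adj_iff[OF X] by blast
    then have neq: "X \<noteq> Z" by blast
    obtain Y where "nbr k X Z Y" using R by (auto simp: N_def)
    then obtain Y1 Y2 Y3 where "Y1 \<in> N" "Y2 \<in> N" "Y3 \<in> N" "Y1 \<noteq> Y2" "Y1 \<noteq> Y3" "Y2 \<noteq> Y3"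
      using transversal_pair_three_nbrs[OF X neq rk] unfolding N_def mem_Collect_eq by metis
    then have "\<exists>Y\<in>N. \<exists>Y'\<in>N. adj k Y Y'" using R by blast
    then show False using transversal_pair_no_adjacent_nbrs[OF X neq rk] by (auto simp: N_def)
  qed
qed

end

section \<open>Descent to subspaces of smaller dimension\<close>

lemma graph_automorphism_inv:
  assumes "graph_automorphism V E f"
  shows "graph_automorphism V E (inv_into V f)"
proof -
  have bij: "bij_betw f V V" and E: "\<And>x y. \<lbrakk>x \<in> V; y \<in> V\<rbrakk> \<Longrightarrow> E (f x) (f y) \<longleftrightarrow> E x y"
    using assms by (auto simp: graph_automorphism_def)
  have inv: "bij_betw (inv_into V f) V V" using bij by (rule bij_betw_inv_into)
  moreover have "E (inv_into V f x) (inv_into V f y) \<longleftrightarrow> E x y" if "x \<in> V" "y \<in> V" for x y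
    using E[of "inv_into V f x" "inv_into V f y"] bij_betwE[OF inv] bij_betw_inv_into_right[OF bij] that
    by simp
  ultimately show ?thesis by (simp add: graph_automorphism_def)
qed

context ranked_polar_space
begin

abbreviation automorphism :: "nat \<Rightarrow> ('a set \<Rightarrow> 'a set) \<Rightarrow> bool" where
  "automorphism k f \<equiv> graph_automorphism (G k) (adj k) f"

definition star :: "nat \<Rightarrow> 'a set \<Rightarrow> 'a set set" where
  "star k S = {X \<in> G k. S \<subseteq> X}"

lemma automorphism_rk_Int:
  assumes f: "automorphism k f" and X: "X \<in> G k" "Z \<in> G k"
  shows "rk (f X \<inter> f Z) = k \<longleftrightarrow> rk (X \<inter> Z) = k"
proof -
  have bij: "bij_betw f (G k) (G k)" and E: "\<And>X Y. \<lbrakk>X \<in> G k; Y \<in> G k\<rbrakk> \<Longrightarrow> adj k (f X) (f Y) \<longleftrightarrow> adj k X Y"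
    using f by (auto simp: graph_automorphism_def)
  have inj: "\<And>X Y. \<lbrakk>X \<in> G k; Y \<in> G k\<rbrakk> \<Longrightarrow> f X = f Y \<longleftrightarrow> X = Y"
    using bij by (meson bij_betw_imp_inj_on inj_on_eq_iff)
  have fX: "f X \<in> G k" "f Z \<in> G k" using bij_betwE[OF bij] X by auto
  define N where "N = {Y. nbr k X Z Y}"
  have N: "Y \<in> G k" if "Y \<in> N" for Y using that by (simp add: N_def nbr_def)
  have "nbr k (f X) (f Z) Y' \<longleftrightarrow> Y' \<in> f ` N" for Y'
  proof
    assume *: "nbr k (f X) (f Z) Y'"
    then obtain Y where Y: "Y \<in> G k" "Y' = f Y"
      using bij unfolding nbr_def bij_betw_def by blast
    then show "Y' \<in> f ` N" using * E X by (auto simp: N_def nbr_def)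
  next
    assume "Y' \<in> f ` N"
    then obtain Y where "Y' = f Y" "nbr k X Z Y" by (auto simp: N_def)
    then show "nbr k (f X) (f Z) Y'" using E X bij_betwE[OF bij] by (simp add: nbr_def)
  qed
  then have eq: "{Y. nbr k (f X) (f Z) Y} = f ` N" by blast
  have three: "(\<exists>Y1\<in>f ` N. \<exists>Y2\<in>f ` N. \<exists>Y3\<in>f ` N. Y1 \<noteq> Y2 \<and> Y1 \<noteq> Y3 \<and> Y2 \<noteq> Y3) \<longleftrightarrow>
     (\<exists>Y1\<in>N. \<exists>Y2\<in>N. \<exists>Y3\<in>N. Y1 \<noteq> Y2 \<and> Y1 \<noteq> Y3 \<and> Y2 \<noteq> Y3)"
    by (simp add: inj N cong: bex_cong)
  have two: "(\<exists>Y\<in>f ` N. \<exists>Y'\<in>f ` N. adj k Y Y') \<longleftrightarrow> (\<exists>Y\<in>N. \<exists>Y'\<in>N. adj k Y Y')"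
    by (simp add: E N cong: bex_cong)
  show ?thesis
    unfolding rk_Int_iff[OF X] rk_Int_iff[OF fX] eq three two N_def[symmetric]
    using E[OF X] inj[OF X] by simp
qed

lemma star_adjacent_pair:
  assumes S: "singular S" "rk S = k" and "k < n"
  shows "\<exists>X\<in>star k S. \<exists>Y\<in>star k S. adj k X Y \<and> X \<inter> Y = S"
proof -
  obtain p q where pq: "p \<in> P" "q \<in> P" "\<forall>s\<in>S. p \<sim> s" "\<forall>s\<in>S. q \<sim> s" "\<not> p \<sim> q"
    using noncollinear_pair[OF S(1)] assms by blast
  then have "p \<notin> S" "q \<notin> S" using col_sym by blast+
  then have X: "span (insert p S) \<in> G k" "span (insert q S) \<in> G k"
    using pq S G_insert by auto
  have a: "adj k (span (insert p S)) (span (insert q S))"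
    using star_adj[OF X S sub_span_insert sub_span_insert in_span_insert in_span_insert pq(5)] .
  then have "span (insert p S) \<inter> span (insert q S) = S"
    using Int_eq[OF X _ S sub_span_insert sub_span_insert] adj_neq[OF X(1) a] by blast
  then show ?thesis using a X sub_span_insert unfolding star_def by blast
qed

lemma star_inj:
  assumes "S \<in> G j" "S' \<in> G j" "Suc j < n" "star (Suc j) S = star (Suc j) S'"
  shows "S = S'"
proof -
  obtain X Y where "X \<in> star (Suc j) S" "Y \<in> star (Suc j) S" "X \<inter> Y = S"
    using star_adjacent_pair[OF G_singular G_rk, of S j] assms by blast
  then have "S' \<subseteq> S" using assms by (auto simp: star_def)
  then show ?thesis using G_subset_eq[OF assms(2,1)] by blast
qed

text \<open>  Take adjacent \<open>X\<close> and \<open>Y\<close> with \<open>X \<inter> Y = S\<close>. By \<open>star_iff\<close>, membership in the star of \<open>X \<inter> Y\<close> is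
  expressed by relations that \<open>f\<close> preserves, so the image is the star of \<open>f X \<inter> f Y\<close>.\<close>

lemma star_image:
  assumes f: "automorphism (Suc j) f" and j: "Suc j < n" and S: "S \<in> G j"
  shows "\<exists>S'\<in>G j. f ` star (Suc j) S = star (Suc j) S'"
proof -
  have bij: "bij_betw f (G (Suc j)) (G (Suc j))"
    and E: "\<And>X Y. \<lbrakk>X \<in> G (Suc j); Y \<in> G (Suc j)\<rbrakk> \<Longrightarrow> adj (Suc j) (f X) (f Y) \<longleftrightarrow> adj (Suc j) X Y"
    using f by (auto simp: graph_automorphism_def)
  have inj: "\<And>X Y. \<lbrakk>X \<in> G (Suc j); Y \<in> G (Suc j)\<rbrakk> \<Longrightarrow> f X = f Y \<longleftrightarrow> X = Y"
    using bij by (meson bij_betw_imp_inj_on inj_on_eq_iff)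
  note fG = bij_betwE[OF bij, rule_format]
  obtain X Y where "X \<in> star (Suc j) S" "Y \<in> star (Suc j) S" and a: "adj (Suc j) X Y" and XY: "X \<inter> Y = S"
    using star_adjacent_pair[OF G_singular[OF S] G_rk[OF S] j] by blast
  then have X: "X \<in> G (Suc j)" "Y \<in> G (Suc j)" by (auto simp: star_def)
  note fX = fG[OF X(1)] fG[OF X(2)]
  have fa: "adj (Suc j) (f X) (f Y)" using E X a by blast
  have "S \<subseteq> Z \<longleftrightarrow> f X \<inter> f Y \<subseteq> f Z" if Z: "Z \<in> G (Suc j)" for Z
    using star_iff[OF X Z a] star_iff[OF fX fG[OF Z] fa] automorphism_rk_Int[OF f _ Z] inj X Z XY
    by simp
  then have "star (Suc j) S = {Z \<in> G (Suc j). f X \<inter> f Y \<subseteq> f Z}" unfolding star_def by blast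
  then have "f ` star (Suc j) S = {Z' \<in> f ` G (Suc j). f X \<inter> f Y \<subseteq> Z'}"
    by (simp only: Compr_image_eq)
  then have "f ` star (Suc j) S = star (Suc j) (f X \<inter> f Y)"
    using bij by (simp add: bij_betw_def star_def)
  moreover have "f X \<inter> f Y \<in> G j"
    using fa adj_iff[OF fX] G_Int_singular[OF fX] by (simp add: G_iff)
  ultimately show ?thesis by blast
qed

text \<open>  From left to right, a point \<open>s'\<close> of \<open>S'\<close> outside \<open>S\<close> is collinear to a point \<open>u\<close> outside \<open>S\<close> of
  any given \<open>X\<close> through \<open>S\<close>, and \<open>u\<close> together with \<open>S'\<close> spans the required \<open>X'\<close>. From right to left, suppose that
  \<open>S \<inter> S'\<close> is too small. Then \<open>X \<inter> X'\<close> meets \<open>S\<close> and \<open>S'\<close> in different hyperplanes, so each \<open>X\<close> is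
  spanned by \<open>S\<close> and a point of \<open>S'\<close>. As points of \<open>S'\<close> are pairwise collinear, all spaces in the
  star of \<open>S\<close> would be orthogonal, but some are adjacent.\<close>

lemma adj_star_iff:
  assumes S: "S \<in> G j" "S' \<in> G j" and j: "Suc j < n"
  defines "k \<equiv> Suc j"
  shows "adj j S S' \<longleftrightarrow> S \<noteq> S' \<and> star k S \<inter> star k S' = {} \<and>
    (\<forall>X\<in>star k S. \<exists>X'\<in>star k S'. adj k X X')"
proof (intro iffI conjI)
  note rkS = G_rk[OF S(1), folded k_def] and rkS' = G_rk[OF S(2), folded k_def]
  note sS = G_singular[OF S(1)] and sS' = G_singular[OF S(2)]
  assume a: "adj j S S'"
  then have no: "\<not> orth S S'" and rk: "rk (S \<inter> S') = j" using adj_iff[OF S] by auto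
  show "S \<noteq> S'" using adj_neq[OF S(1) a] .
  show "star k S \<inter> star k S' = {}"
  proof (rule equals0I)
    fix X assume "X \<in> star k S \<inter> star k S'"
    then have "X \<in> G k" "S \<subseteq> X" "S' \<subseteq> X" by (auto simp: star_def)
    then show False using no G_col unfolding orth_def by blast
  qed
  obtain s s' where s: "s \<in> S" "s' \<in> S'" "\<not> s \<sim> s'" using no unfolding orth_def by blast
  define T where "T = S \<inter> S'"
  have T: "singular T" "rk T = j" "T \<subseteq> S" "T \<subseteq> S'"
    using rk singular_Int[OF sS sS'] by (auto simp: T_def)
  have nT: "s \<notin> S'" "s' \<notin> S" using s G_col[OF S(1)] G_col[OF S(2)] by blast+
  show "\<forall>X\<in>star k S. \<exists>X'\<in>star k S'. adj k X X'"
  proof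
    fix X assume "X \<in> star k S"
    then have X: "X \<in> G k" "S \<subseteq> X" by (auto simp: star_def)
    obtain x0 where x0: "x0 \<in> X" "x0 \<notin> S"
      using G_rk[OF X(1)] rkS X(2) by (metis n_not_Suc_n subsetI subset_antisym)
    have "s \<noteq> x0" "s \<in> X" using s x0 X by auto
    then obtain l where l: "l \<in> L" "s \<in> l" "x0 \<in> l" using join G_col[OF X(1) _ x0(1)] by blast
    have lX: "l \<subseteq> X" using G_line[OF X(1) \<open>s \<in> X\<close> x0(1) \<open>s \<noteq> x0\<close> l] .
    obtain u where u: "u \<in> l" "s' \<sim> u" using col_some[OF G_points[OF S(2) s(2)] l(1)] by blast
    have us: "u \<noteq> s" using u s col_sym by blast
    have "u \<in> X" using u lX by blast
    have uS: "u \<notin> S" using G_line[OF S(1) _ s(1) us l(1) u(1) l(2)] x0 l by blast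
    have uP: "u \<in> P" using line_point[OF l(1) u(1)] .
    have S'_span: "span (insert s' T) = S'"
      using span_insert_eq[OF sS' T(1) T(4) _ s(2)] nT T rkS' by (simp add: k_def T_def)
    have uT: "\<forall>t\<in>insert s' T. u \<sim> t"
      using G_col[OF X(1) \<open>u \<in> X\<close>] T X u(2) col_sym by blast
    have uS'col: "u \<sim> t" if "t \<in> S'" for t
    proof (rule col_span[OF uT])
      show "insert s' T \<subseteq> P" using s T G_points[OF S(2)] by blast
      show "t \<in> span (insert s' T)" using that S'_span by simp
    qed
    have "u \<notin> S'"
    proof
      assume u': "u \<in> S'"
      then have "span (insert u T) = S'"
        using span_insert_eq[OF sS' T(1) T(4) _ u'] uS T rkS' by (simp add: k_def T_def)
      moreover have "\<forall>t\<in>insert u T. s \<sim> t" using G_col[OF X(1) \<open>s \<in> X\<close>] T X \<open>u \<in> X\<close> by blast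
      ultimately have "s \<sim> s'"
        using col_span[of "insert u T" s s'] s(2) T uP G_points[OF S(2)] by blast
      then show False using s by blast
    qed
    then have X': "span (insert u S') \<in> G k" using G_insert[OF sS' rkS' uP] uS'col by blast
    let ?V = "span (insert u T)"
    have VX: "?V \<subseteq> X"
      using \<open>u \<in> X\<close> T X singular_subspace[OF G_singular[OF X(1)]] by (intro span_least) auto
    have VX': "?V \<subseteq> span (insert u S')" using T by (intro span_mono) blast
    have uT2: "\<forall>t\<in>T. u \<sim> t" "u \<notin> T" using uT uS T by auto
    have V: "singular ?V" "rk ?V = k"
      using singular_insert[OF T(1) uP uT2(1)] rk_insert[OF T(1) uP uT2] T(2) by (auto simp: k_def)
    have "s' \<in> span (insert u S')" using s sub_span_insert by blast
    then have "adj k X (span (insert u S'))"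
      using star_adj[OF X(1) X' V VX VX' \<open>s \<in> X\<close> _ s(3)] by blast
    then show "\<exists>X'\<in>star k S'. adj k X X'" using X' sub_span_insert unfolding star_def by blast
  qed
next
  note rkS = G_rk[OF S(1), folded k_def] and rkS' = G_rk[OF S(2), folded k_def]
  note sS = G_singular[OF S(1)] and sS' = G_singular[OF S(2)]
  assume *: "S \<noteq> S' \<and> star k S \<inter> star k S' = {} \<and> (\<forall>X\<in>star k S. \<exists>X'\<in>star k S'. adj k X X')"
  then have neq: "S \<noteq> S'" and disj: "\<And>X. \<lbrakk>X \<in> G k; S \<subseteq> X; S' \<subseteq> X\<rbrakk> \<Longrightarrow> False"
    and ex: "\<And>X. X \<in> star k S \<Longrightarrow> \<exists>X'\<in>star k S'. adj k X X'"
    by (auto simp: star_def)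
  have rk: "rk (S \<inter> S') = j"
  proof (rule ccontr)
    assume rk: "rk (S \<inter> S') \<noteq> j"
    \<comment> \<open>Note that \<open>X\<close> does not contain \<open>S'\<close> and \<open>X'\<close> does not contain \<open>S\<close>, as the stars are disjoint.\<close>
    have pt: "\<exists>a\<in>S'. a \<in> X \<and> a \<notin> S" if X: "X \<in> star k S" for X
    proof -
      obtain X' where "X' \<in> star k S'" and a: "adj k X X'" using ex[OF X] by blast
      then have G': "X \<in> G k" "X' \<in> G k" and sub: "S \<subseteq> X" "S' \<subseteq> X'"
        using X by (auto simp: star_def)
      define V where "V = X \<inter> X'"
      have V: "singular V" "rk V = k" "V \<subseteq> X" "V \<subseteq> X'"
        using G_Int_singular[OF G'] adj_iff[OF G'] a by (auto simp: V_def)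
      have "\<not> S \<subseteq> V" using disj[OF G'(2) _ sub(2)] V by blast
      then have rS: "rk S = Suc (rk (S \<inter> V))"
        using rk_Int_hyperplane[OF G_singular[OF G'(1)] V(1,3) _ sS sub(1)] V G_rk[OF G'(1)] by simp
      have "\<not> S' \<subseteq> V" using disj[OF G'(1) sub(1)] V by blast
      then have rS': "rk S' = Suc (rk (S' \<inter> V))"
        using rk_Int_hyperplane[OF G_singular[OF G'(2)] V(1,4) _ sS' sub(2)] V G_rk[OF G'(2)] by simp
      have "\<not> S' \<inter> V \<subseteq> S"
      proof
        assume "S' \<inter> V \<subseteq> S"
        then have "S \<inter> S' = S' \<inter> V"
          using Int_eq[OF S neq singular_Int[OF sS' V(1)]] rS' rkS' by (simp add: k_def)
        then show False using rk rS' rkS' by (simp add: k_def)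
      qed
      then show ?thesis using V by blast
    qed
    have "k < n" using j by (simp add: k_def)
    obtain X Y where X: "X \<in> star k S" and Y: "Y \<in> star k S" and a: "adj k X Y"
      using star_adjacent_pair[OF sS rkS \<open>k < n\<close>] by blast
    obtain p q where p: "p \<in> S'" "p \<in> X" "p \<notin> S" and q: "q \<in> S'" "q \<in> Y" "q \<notin> S"
      using pt[OF X] pt[OF Y] by blast
    have XY: "X \<in> G k" "Y \<in> G k" "S \<subseteq> X" "S \<subseteq> Y" using X Y by (auto simp: star_def)
    have "orth X Y"
      using star_orth[OF XY(1,2) sS rkS XY(3,4) p(2,3) q(2,3)] G_col[OF S(2) p(1) q(1)] by blast
    then show False using adj_iff[OF XY(1,2)] a by blast
  qed
  moreover have "\<not> orth S S'"
  proof
    assume o: "orth S S'"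
    obtain p where p: "p \<in> S'" "p \<notin> S" using G_subset_eq[OF S(2,1)] neq by blast
    have "\<forall>s\<in>S. p \<sim> s" using o p col_sym unfolding orth_def by blast
    then have X: "span (insert p S) \<in> G k" using G_insert[OF sS rkS] p G_points[OF S(2)] by blast
    have "span (insert p (S \<inter> S')) = S'"
      using span_insert_eq[OF sS' singular_Int[OF sS sS'] _ _ p(1)] p rk rkS' by (simp add: k_def)
    then have "S' \<subseteq> span (insert p S)"
      using span_mono[of "insert p (S \<inter> S')" "insert p S"] by blast
    then show False using disj[OF X sub_span_insert] by blast
  qed
  ultimately show "adj j S S'" using adj_iff[OF S] by blast
qed

section \<open>Graph automorphisms are induced by collineations\<close>

lemma line_eq_perp_perp:
  assumes "l \<in> L" "x \<in> l" "y \<in> l" "x \<noteq> y" "p \<in> P"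
  shows "p \<in> l \<longleftrightarrow> (\<forall>q\<in>P. q \<sim> x \<longrightarrow> q \<sim> y \<longrightarrow> q \<sim> p)"
proof
  assume "p \<in> l"
  then show "\<forall>q\<in>P. q \<sim> x \<longrightarrow> q \<sim> y \<longrightarrow> q \<sim> p" using col_all[OF assms(1-4)] by blast
next
  assume *: "\<forall>q\<in>P. q \<sim> x \<longrightarrow> q \<sim> y \<longrightarrow> q \<sim> p"
  show "p \<in> l"
  proof (rule ccontr)
    assume "p \<notin> l"
    then obtain q where "q \<in> P" "\<forall>s\<in>l. q \<sim> s" "\<not> q \<sim> p"
      using separate[OF singular_line[OF assms(1)] assms(5)] by blast
    then show False using * assms by blast
  qed
qed

lemma collinearity_automorphism:
  assumes bij: "bij_betw \<phi> P P" and col: "\<And>x y. \<lbrakk>x \<in> P; y \<in> P\<rbrakk> \<Longrightarrow> \<phi> x \<sim> \<phi> y \<longleftrightarrow> x \<sim> y"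
  shows "geometry_automorphism P L \<phi>"
proof -
  have surj: "\<phi> ` P = P" and inj: "inj_on \<phi> P" using bij by (auto simp: bij_betw_def)
  have img: "\<phi> ` l = m"
    if l: "l \<in> L" "x \<in> l" "y \<in> l" "x \<noteq> y" and m: "m \<in> L" "\<phi> x \<in> m" "\<phi> y \<in> m" for l m x y
  proof -
    have xy: "x \<in> P" "y \<in> P" using l line_point by auto
    then have neq: "\<phi> x \<noteq> \<phi> y" using inj l(4) by (auto dest: inj_onD)
    have "\<phi> p \<in> m \<longleftrightarrow> p \<in> l" if p: "p \<in> P" for p
    proof -
      have "\<phi> p \<in> P" using surj p by blast
      then have "\<phi> p \<in> m \<longleftrightarrow> (\<forall>q\<in>\<phi> ` P. q \<sim> \<phi> x \<longrightarrow> q \<sim> \<phi> y \<longrightarrow> q \<sim> \<phi> p)"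
        using line_eq_perp_perp[OF m neq] surj by simp
      also have "\<dots> \<longleftrightarrow> (\<forall>q\<in>P. q \<sim> x \<longrightarrow> q \<sim> y \<longrightarrow> q \<sim> p)" using col xy p by simp
      also have "\<dots> \<longleftrightarrow> p \<in> l" using line_eq_perp_perp[OF l p] by simp
      finally show ?thesis .
    qed
    moreover have "l \<subseteq> P" "m \<subseteq> \<phi> ` P" using line_point l m surj by auto
    ultimately show ?thesis by blast
  qed
  have "\<exists>m\<in>L. \<phi> ` l = m" if l: "l \<in> L" for l
  proof -
    obtain x y where xy: "x \<in> l" "y \<in> l" "x \<noteq> y" using line_two_points[OF l] by blast
    then have "\<phi> x \<sim> \<phi> y" "\<phi> x \<noteq> \<phi> y"
      using col on_line_col[OF l xy(1,2)] line_point[OF l] inj by (auto dest: inj_onD)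
    then obtain m where "m \<in> L" "\<phi> x \<in> m" "\<phi> y \<in> m" using join by blast
    then show ?thesis using img[OF l xy] by blast
  qed
  moreover have "\<exists>l\<in>L. \<phi> ` l = m" if m: "m \<in> L" for m
  proof -
    obtain x' y' where xy': "x' \<in> m" "y' \<in> m" "x' \<noteq> y'" using line_two_points[OF m] by blast
    obtain x where x: "x \<in> P" "x' = \<phi> x" using line_point[OF m xy'(1)] surj by blast
    obtain y where y: "y \<in> P" "y' = \<phi> y" using line_point[OF m xy'(2)] surj by blast
    have "x \<sim> y" using on_line_col[OF m xy'(1,2)] col x y by blast
    moreover have "x \<noteq> y" using xy' x y by blast
    ultimately obtain l where "l \<in> L" "x \<in> l" "y \<in> l" using join by blast
    then show ?thesis using img[of l x y m] m xy' x y \<open>x \<noteq> y\<close> by blast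
  qed
  ultimately have "(\<lambda>l. \<phi> ` l) ` L = L" by (auto simp: image_iff) metis
  then show ?thesis using bij by (simp add: geometry_automorphism_def)
qed

lemma G_0: "X \<in> G 0 \<longleftrightarrow> (\<exists>p\<in>P. X = {p})"
proof
  assume X: "X \<in> G 0"
  then have "X \<noteq> {}" using G_rk[OF X] rk_empty by auto
  then obtain p where p: "p \<in> X" by blast
  then have "p \<in> P" using G_points[OF X] by blast
  moreover have "{p} = X"
    using rk_subset_eq[OF G_singular[OF X] singular_point[OF \<open>p \<in> P\<close>]] p
      rk_point[OF \<open>p \<in> P\<close>] G_rk[OF X] by simp
  ultimately show "\<exists>p\<in>P. X = {p}" by blast
next
  assume "\<exists>p\<in>P. X = {p}"
  then show "X \<in> G 0" using singular_point rk_point by (auto simp: G_iff)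
qed

lemma adj_0: "\<lbrakk>p \<in> P; q \<in> P\<rbrakk> \<Longrightarrow> adj 0 {p} {q} \<longleftrightarrow> \<not> p \<sim> q"
  using adj_iff[of "{p}" 0 "{q}"] G_0 rk_empty by (cases "p = q") (auto simp: orth_def)

lemma point_graph_automorphism:
  assumes "automorphism 0 f"
  shows "\<exists>\<phi>. geometry_automorphism P L \<phi> \<and> (\<forall>S\<in>G 0. f S = \<phi> ` S)"
proof -
  have bij: "bij_betw f (G 0) (G 0)" and E: "\<And>X Y. \<lbrakk>X \<in> G 0; Y \<in> G 0\<rbrakk> \<Longrightarrow> adj 0 (f X) (f Y) \<longleftrightarrow> adj 0 X Y"
    using assms by (auto simp: graph_automorphism_def)
  have pG: "{p} \<in> G 0" if "p \<in> P" for p using that G_0 by blast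
  have "\<exists>q\<in>P. f {p} = {q}" if "p \<in> P" for p using bij_betwE[OF bij] pG[OF that] G_0 by blast
  then obtain \<phi> where \<phi>: "\<And>p. p \<in> P \<Longrightarrow> \<phi> p \<in> P" "\<And>p. p \<in> P \<Longrightarrow> f {p} = {\<phi> p}" by metis
  have "bij_betw \<phi> P P"
  proof (rule bij_betw_imageI)
    show "inj_on \<phi> P"
    proof (rule inj_onI)
      fix p q assume "p \<in> P" "q \<in> P" "\<phi> p = \<phi> q"
      then have "f {p} = f {q}" using \<phi> by simp
      then show "p = q" using bij_betw_imp_inj_on[OF bij] pG \<open>p \<in> P\<close> \<open>q \<in> P\<close> by (auto dest: inj_onD)
    qed
    have "q \<in> \<phi> ` P" if q: "q \<in> P" for q
    proof -
      obtain X where "X \<in> G 0" "f X = {q}" 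
        using pG[OF q] bij_betw_imp_surj_on[OF bij] by (metis imageE)
      then obtain p where "p \<in> P" "f {p} = {q}" using G_0 by auto
      then show ?thesis using \<phi> by auto
    qed
    then show "\<phi> ` P = P" using \<phi>(1) by blast
  qed
  moreover have "\<phi> x \<sim> \<phi> y \<longleftrightarrow> x \<sim> y" if "x \<in> P" "y \<in> P" for x y
    using E[OF pG pG] adj_0 \<phi> that by metis
  ultimately have "geometry_automorphism P L \<phi>" by (rule collinearity_automorphism)
  moreover have "\<forall>S\<in>G 0. f S = \<phi> ` S" using G_0 \<phi> by auto
  ultimately show ?thesis by blast
qed

text \<open>  \<open>F\<close> is injective because a \<open>j\<close>-space is the intersection of two members of its
  star; it is surjective because the inverse of \<open>f\<close> maps stars to stars as well.\<close>

lemma induced_automorphism_below: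
  assumes f: "automorphism (Suc j) f" and j: "Suc j < n"
  obtains F where "automorphism j F" "\<And>S. S \<in> G j \<Longrightarrow> f ` star (Suc j) S = star (Suc j) (F S)"
proof -
  have bij: "bij_betw f (G (Suc j)) (G (Suc j))"
    and E: "\<And>X Y. \<lbrakk>X \<in> G (Suc j); Y \<in> G (Suc j)\<rbrakk> \<Longrightarrow> adj (Suc j) (f X) (f Y) \<longleftrightarrow> adj (Suc j) X Y"
    using f by (auto simp: graph_automorphism_def)
  note inj = bij_betw_imp_inj_on[OF bij]
  have starG: "star (Suc j) S \<subseteq> G (Suc j)" for S by (auto simp: star_def)
  obtain F where F: "\<And>S. S \<in> G j \<Longrightarrow> F S \<in> G j"
    and FS: "\<And>S. S \<in> G j \<Longrightarrow> f ` star (Suc j) S = star (Suc j) (F S)"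
    using star_image[OF f j] by metis
  have "bij_betw F (G j) (G j)"
  proof (rule bij_betw_imageI)
    show "inj_on F (G j)"
    proof (rule inj_onI)
      fix S S' assume S: "S \<in> G j" "S' \<in> G j" "F S = F S'"
      then have "f ` star (Suc j) S = f ` star (Suc j) S'" using FS by simp
      then have "star (Suc j) S = star (Suc j) S'"
        by (simp add: inj_on_image_eq_iff[OF inj starG starG])
      then show "S = S'" using star_inj S j by blast
    qed
    have "S' \<in> F ` G j" if S': "S' \<in> G j" for S'
    proof -
      obtain S where S: "S \<in> G j" "inv_into (G (Suc j)) f ` star (Suc j) S' = star (Suc j) S"
        using star_image[OF graph_automorphism_inv[OF f] j S'] by blast
      have "f ` star (Suc j) S = star (Suc j) S'"
        using image_inv_into_cancel[OF bij_betw_imp_surj_on[OF bij] starG] S(2) by metis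
      then have "F S = S'" using star_inj[OF F[OF S(1)] S' j] FS[OF S(1)] by simp
      then show ?thesis using S by blast
    qed
    then show "F ` G j = G j" using F by blast
  qed
  moreover have "adj j (F S) (F S') \<longleftrightarrow> adj j S S'" if S: "S \<in> G j" "S' \<in> G j" for S S'
  proof -
    have "F S = F S' \<longleftrightarrow> S = S'"
      using calculation S by (meson bij_betw_imp_inj_on inj_on_eq_iff)
    moreover have "f ` star (Suc j) S \<inter> f ` star (Suc j) S' = {} \<longleftrightarrow> star (Suc j) S \<inter> star (Suc j) S' = {}"
      using inj_on_image_Int[OF inj starG[of S] starG[of S']] by (metis image_is_empty)
    moreover have "(\<forall>X\<in>f ` star (Suc j) S. \<exists>X'\<in>f ` star (Suc j) S'. adj (Suc j) X X') \<longleftrightarrow>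
      (\<forall>X\<in>star (Suc j) S. \<exists>X'\<in>star (Suc j) S'. adj (Suc j) X X')"
      using E starG by (simp add: subset_iff cong: ball_cong bex_cong)
    ultimately show ?thesis
      unfolding adj_star_iff[OF S j] adj_star_iff[OF F[OF S(1)] F[OF S(2)] j] FS[OF S(1), symmetric] FS[OF S(2), symmetric]
      by simp
  qed
  ultimately have "automorphism j F" by (simp add: graph_automorphism_def)
  then show thesis using that FS by blast
qed

lemma point_in_hyperplane:
  assumes "X \<in> G (Suc j)" "x \<in> X"
  shows "\<exists>S\<in>G j. S \<subseteq> X \<and> x \<in> S"
proof -
  have x: "x \<in> P" using G_points assms by blast
  then have "rk {x} \<le> Suc j" "Suc j \<le> rk X" using rk_point G_rk[OF assms(1)] by auto
  then show ?thesis
    using intermediate_subspace[OF G_singular[OF assms(1)] singular_point[OF x], of "Suc j"] assms(2)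
    unfolding Bex_def G_iff by (simp add: conj_ac)
qed

text \<open>  Induction on \<open>k\<close>. The automorphism \<open>\<phi>\<close> that induces \<open>F\<close> on the \<open>j\<close>-spaces induces \<open>f\<close>, because \<open>f\<close> and
  \<open>F\<close> together preserve inclusion of \<open>j\<close>-spaces in \<open>k\<close>-spaces, and a \<open>k\<close>-space is the union of the
  \<open>j\<close>-spaces in it.\<close>

lemma automorphism_induced:
  assumes "k \<le> n - 2" "automorphism k f"
  shows "\<exists>\<phi>. geometry_automorphism P L \<phi> \<and> (\<forall>S\<in>G k. f S = \<phi> ` S)"
  using assms
proof (induction k arbitrary: f)
  case 0
  then show ?case using point_graph_automorphism by blast
next
  case (Suc j)
  have j: "Suc j < n" using Suc.prems rank_ge by simp
  note f = Suc.prems(2)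
  have bij: "bij_betw f (G (Suc j)) (G (Suc j))" using f by (simp add: graph_automorphism_def)
  obtain F where F: "automorphism j F" "\<And>S. S \<in> G j \<Longrightarrow> f ` star (Suc j) S = star (Suc j) (F S)"
    using induced_automorphism_below[OF f j] by blast
  obtain \<phi> where \<phi>: "geometry_automorphism P L \<phi>" "\<And>S. S \<in> G j \<Longrightarrow> F S = \<phi> ` S"
    using Suc.IH[OF _ F(1)] Suc.prems by auto
  have sub: "S \<subseteq> X \<longleftrightarrow> \<phi> ` S \<subseteq> f X" if "S \<in> G j" "X \<in> G (Suc j)" for S X
  proof -
    have "S \<subseteq> X \<longleftrightarrow> X \<in> star (Suc j) S" using that by (simp add: star_def)
    also have "\<dots> \<longleftrightarrow> f X \<in> f ` star (Suc j) S"
      using inj_on_image_mem_iff[OF bij_betw_imp_inj_on[OF bij] that(2), of "star (Suc j) S"]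
      by (auto simp: star_def)
    also have "\<dots> \<longleftrightarrow> \<phi> ` S \<subseteq> f X"
      using F(2)[OF that(1)] \<phi>(2)[OF that(1)] bij_betwE[OF bij] that(2) by (simp add: star_def)
    finally show ?thesis .
  qed
  have "f X = \<phi> ` X" if X: "X \<in> G (Suc j)" for X
  proof
    have fX: "f X \<in> G (Suc j)" using bij_betwE[OF bij] X by blast
    show "f X \<subseteq> \<phi> ` X"
    proof
      fix y assume "y \<in> f X"
      then obtain S' where S': "S' \<in> G j" "S' \<subseteq> f X" "y \<in> S'" using point_in_hyperplane[OF fX] by blast
      then obtain S where S: "S \<in> G j" "S' = \<phi> ` S"
        using F(1) \<phi>(2) unfolding graph_automorphism_def by (metis bij_betw_imp_surj_on imageE)
      then have "S \<subseteq> X" using sub[OF S(1) X] S' by blast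
      then show "y \<in> \<phi> ` X" using S S' by blast
    qed
    show "\<phi> ` X \<subseteq> f X"
    proof
      fix y assume "y \<in> \<phi> ` X"
      then obtain x where x: "x \<in> X" "y = \<phi> x" by blast
      then obtain S where S: "S \<in> G j" "S \<subseteq> X" "x \<in> S" using point_in_hyperplane[OF X] by blast
      then show "y \<in> f X" using sub[OF S(1) X] x by blast
    qed
  qed
  then show ?case using \<phi>(1) by blast
qed

end

theorem theorem1:
  fixes P :: "'a set" and L :: "'a set set" and n k :: nat and f :: "'a set \<Rightarrow> 'a set"
  assumes "polar_space P L" and "polar_rank P L n" and "3 \<le> n" and "k \<le> n - 2"
    and "graph_automorphism (polar_grassmannian P L k) (adj11 P L k) f"
  shows "\<exists>\<phi>. geometry_automorphism P L \<phi> \<and> (\<forall>S \<in> polar_grassmannian P L k. f S = \<phi> ` S)"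
proof -
  interpret polar_space P L by fact
  interpret ranked_polar_space P L n by unfold_locales fact+
  show ?thesis using automorphism_induced assms(4,5) .
qed

end
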